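(* Let $A$ be a unital semi-simple commutative Banach algebra, let $U$ be an automorphism of $A$ with induced homeomorphism $\varphi$ of $\mathfrak{M}_A$, and let $w \in A^{-1}$ (an invertible element of $A$). Let $T = wU$ on $A$ and let $\check{T}$ be the associated weighted composition operator on $\check{A}$, $(\check{T}g)(t) = \check{w}(t)g(\varphi(t))$. Assume that (i) $U^n \neq I$ for all $n \in \mathbb{N}$, and (ii) $\displaystyle\sum_{n=-\infty}^{\infty} \frac{|\ln \|(\check{T})^n\||}{1+n^2} < \infty$, where $\|\cdot\|$ is the operator norm on $\check{A}$. Then $\sigma(T) \supseteq \mathbb{T}$, where $\mathbb{T}$ is the unit circle.
   Context: $A$ is a unital commutative semi-simple Banach algebra with maximal ideal space $\mathfrak{M}_A$ and Shilov boundary $\partial A \subseteq \mathfrak{M}_A$. For $f \in A$, $\hat f \in C(\mathfrak{M}_A)$ is its Gelfand transform and $\check f = \hat f|_{\partial A}$; $\check{A}$ is the closure of $\{\check f : f \in A\}$ in $C(\partial A)$ with the sup norm. An automorphism $U$ of $A$ induces a homeomorphism $\varphi$ of $\mathfrak{M}_A$ onto itself via $F_{\varphi(m)} = U' F_m$ ($U'$ the Banach adjoint, $F_m$ the multiplicative functional of $m$), i.e. $\widehat{Uf}(m) = \hat f(\varphi(m))$; one has $\varphi(\partial A) = \partial A$. For $w \in A$, $T = wU$ is the operator $Tf = w\cdot Uf$ on $A$, and $\check T$ is the operator on $\check A$ given by $(\check{T}g)(t) = \check{w}(t)g(\varphi(t))$, $t \in \partial A$. Since $w$ is invertible, $\check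 T$ is invertible and negative powers make sense. $\sigma(\cdot)$ denotes the spectrum. *)

theory Defs
  imports "HOL-Analysis.Analysis"
begin

text \<open>A complex unital commutative Banach algebra is modelled as a type of class
  banach, real_normed_algebra_1, comm_ring_1 together with a complex scalar
  multiplication sc extending the real one.\<close>

definition complex_banach_algebra ::
  "(complex \<Rightarrow> 'a::{banach,real_normed_algebra_1,comm_ring_1} \<Rightarrow> 'a) \<Rightarrow> bool" where
  "complex_banach_algebra sc \<longleftrightarrow>
     (\<forall>r x. sc (complex_of_real r) x = scaleR r x) \<and>
     (\<forall>a b x. sc (a + b) x = sc a x + sc b x) \<and>
     (\<forall>a x y. sc a (x + y) = sc a x + sc a y) \<and>
     (\<forall>a b x. sc (a * b) x = sc a (sc b x)) \<and>
     (\<forall>a x. norm (sc a x) = cmod a * norm x) \<and>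
     (\<forall>a x y. sc a (x * y) = sc a x * y)"

definition is_character :: "(complex \<Rightarrow> 'a::comm_ring_1 \<Rightarrow> 'a) \<Rightarrow> ('a \<Rightarrow> complex) \<Rightarrow> bool" where
  "is_character sc m \<longleftrightarrow> m 1 = 1 \<and> (\<forall>x y. m (x * y) = m x * m y) \<and>
     (\<forall>x y. m (x + y) = m x + m y) \<and> (\<forall>c x. m (sc c x) = c * m x)"

definition max_ideal_space :: "(complex \<Rightarrow> 'a::comm_ring_1 \<Rightarrow> 'a) \<Rightarrow> ('a \<Rightarrow> complex) set" where
  "max_ideal_space sc = {m. is_character sc m}"

definition gelfand_topology :: "(complex \<Rightarrow> 'a::comm_ring_1 \<Rightarrow> 'a) \<Rightarrow> ('a \<Rightarrow> complex) topology" where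
  "gelfand_topology sc = subtopology (product_topology (\<lambda>_. euclidean) UNIV) (max_ideal_space sc)"

definition semisimple :: "(complex \<Rightarrow> 'a::comm_ring_1 \<Rightarrow> 'a) \<Rightarrow> bool" where
  "semisimple sc \<longleftrightarrow> (\<forall>f. (\<forall>m\<in>max_ideal_space sc. m f = 0) \<longrightarrow> f = 0)"

definition is_boundary :: "(complex \<Rightarrow> 'a::comm_ring_1 \<Rightarrow> 'a) \<Rightarrow> ('a \<Rightarrow> complex) set \<Rightarrow> bool" where
  "is_boundary sc B \<longleftrightarrow> B \<subseteq> max_ideal_space sc \<and>
     (\<forall>f. \<exists>t\<in>B. \<forall>m\<in>max_ideal_space sc. cmod (m f) \<le> cmod (t f))"

definition shilov_boundary :: "(complex \<Rightarrow> 'a::comm_ring_1 \<Rightarrow> 'a) \<Rightarrow> ('a \<Rightarrow> complex) set" where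
  "shilov_boundary sc = \<Inter>{B. is_boundary sc B \<and> closedin (gelfand_topology sc) B}"

text \<open>Check-A: closure in the sup norm of the restrictions of Gelfand transforms to the
  Shilov boundary (elements represented as extensional functions on the boundary).\<close>
definition check_algebra :: "(complex \<Rightarrow> 'a::comm_ring_1 \<Rightarrow> 'a) \<Rightarrow> (('a \<Rightarrow> complex) \<Rightarrow> complex) set" where
  "check_algebra sc = {g \<in> extensional (shilov_boundary sc).
      \<forall>e>0. \<exists>f. \<forall>t\<in>shilov_boundary sc. cmod (g t - t f) < e}"

definition sup_norm :: "(complex \<Rightarrow> 'a::comm_ring_1 \<Rightarrow> 'a) \<Rightarrow> (('a \<Rightarrow> complex) \<Rightarrow> complex) \<Rightarrow> real" where
  "sup_norm sc g = (SUP t\<in>shilov_boundary sc. cmod (g t))"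

definition check_op :: "(complex \<Rightarrow> 'a::comm_ring_1 \<Rightarrow> 'a) \<Rightarrow> 'a \<Rightarrow> ('a \<Rightarrow> 'a) \<Rightarrow>
    (('a \<Rightarrow> complex) \<Rightarrow> complex) \<Rightarrow> (('a \<Rightarrow> complex) \<Rightarrow> complex)" where
  "check_op sc w U g = restrict (\<lambda>t. t w * g (t \<circ> U)) (shilov_boundary sc)"

definition check_op_pow :: "(complex \<Rightarrow> 'a::comm_ring_1 \<Rightarrow> 'a) \<Rightarrow> 'a \<Rightarrow> ('a \<Rightarrow> 'a) \<Rightarrow> int \<Rightarrow>
    (('a \<Rightarrow> complex) \<Rightarrow> complex) \<Rightarrow> (('a \<Rightarrow> complex) \<Rightarrow> complex)" where
  "check_op_pow sc w U n =
     (if 0 \<le> n then check_op sc w U ^^ nat n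
      else inv_into (check_algebra sc) (check_op sc w U) ^^ nat (- n))"

definition check_op_norm :: "(complex \<Rightarrow> 'a::comm_ring_1 \<Rightarrow> 'a) \<Rightarrow>
    ((('a \<Rightarrow> complex) \<Rightarrow> complex) \<Rightarrow> (('a \<Rightarrow> complex) \<Rightarrow> complex)) \<Rightarrow> real" where
  "check_op_norm sc S = (SUP g\<in>{g\<in>check_algebra sc. sup_norm sc g \<le> 1}. sup_norm sc (S g))"

definition algebra_automorphism :: "(complex \<Rightarrow> 'a::comm_ring_1 \<Rightarrow> 'a) \<Rightarrow> ('a \<Rightarrow> 'a) \<Rightarrow> bool" where
  "algebra_automorphism sc U \<longleftrightarrow> bij U \<and> U 1 = 1 \<and>
     (\<forall>x y. U (x + y) = U x + U y) \<and> (\<forall>x y. U (x * y) = U x * U y) \<and>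
     (\<forall>c x. U (sc c x) = sc c (U x))"

definition op_spectrum :: "(complex \<Rightarrow> 'a::{real_normed_vector,comm_ring_1} \<Rightarrow> 'a) \<Rightarrow> ('a \<Rightarrow> 'a) \<Rightarrow> complex set" where
  "op_spectrum sc S = {c. \<not> (\<exists>R. (\<exists>K. \<forall>x. norm (R x) \<le> K * norm x) \<and>
       (\<forall>x. R (S x - sc c x) = x) \<and> (\<forall>x. S (R x) - sc c (R x) = x))}"

end

theory Submission
  imports Defs "HOL-Library.Discrete_Functions"
begin

text \<open>Suppose z on the unit circle is not in the spectrum of T. For t in the Shilov boundary and f in A
  put a(n) = t (T^n f), n an integer. The resolvent (T - x)^(-1) f exists for x near z, so the two
  power series built from a(n), n \<ge> 0, and from a(n), n < 0, continue each other across an arc around z: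
  the Abel means of the Fourier series with coefficients a(n) tend to 0 uniformly there.
  Averaging a function over \<theta> + e and \<theta> - e multiplies its n-th Fourier coefficient by cos (n e). Finitely
  many such averages with small total shift are harmless on a smaller arc. Let ||T^n|| denote the norm of
  the n-th power on the closure of the restrictions to the Shilov boundary. Since
  ln ||T^n|| / (1 + n^2) is summable and ln ||T^n|| is subadditive, shifts e = \<pi> / (3 2^j), each repeated
  suitably often, produce a summable sequence \<kappa>(n) ||T^n|| with |a(0)| \<le> \<Sum> \<kappa>(n) |a(n)| over n \<noteq> 0,
  where \<kappa> depends on neither t nor f.
  If the points of the Shilov boundary have unbounded periods under \<phi>, a function f peaking at t inside a
  small open set V that is disjoint from many of its iterates makes the right-hand side smaller than
  |a(0)| = 1. If the periods are bounded, a power of U is the identity by semisimplicity.\<close>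

subsection \<open>Subadditive sequences and cosine products\<close>

lemma subadditive_dyadic_majorant:
  fixes q :: "nat \<Rightarrow> real"
  assumes nonneg: "\<And>n. 0 \<le> q n"
    and subadd: "\<And>m n. q (m + n) \<le> q m + q n"
    and summ: "summable (\<lambda>n. q n / (1 + (real n)\<^sup>2))"
  obtains D where "\<And>j. 0 \<le> D j" and "\<And>j n. 2 ^ j \<le> n \<Longrightarrow> n < 2 ^ Suc j \<Longrightarrow> q n \<le> D j"
    and "summable (\<lambda>j. D j / 2 ^ j)"
proof -
  define F where "F j = (\<Sum>k<2^j. q k)" for j :: nat
  define x where "x j = F j / 4 ^ j" for j
  have F_nonneg: "0 \<le> F j" for j
    unfolding F_def by (simp add: sum_nonneg nonneg)
  have x_nonneg: "0 \<le> x j" for j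
    unfolding x_def using F_nonneg by simp
  have potential: "(\<Sum>j<J. x j) + 4/3 * x J \<le> 4/3 * (\<Sum>k<2^J. q k / (1 + (real k)\<^sup>2))" for J
  proof (induction J)
    case 0
    then show ?case by (simp add: x_def F_def)
  next
    case (Suc J)
    have split: "(\<Sum>k<2^Suc J. f k) = (\<Sum>k<2^J. f k) + (\<Sum>k=2^J..<2^Suc J. f k)" for f :: "nat \<Rightarrow> real"
      unfolding lessThan_atLeast0 by (simp add: sum.atLeastLessThan_concat)
    have "(\<Sum>k=2^J..<2^Suc J. q k) / 4 ^ Suc J \<le> (\<Sum>k=2^J..<2^Suc J. q k / (1 + (real k)\<^sup>2))"
      unfolding sum_divide_distrib
    proof (rule sum_mono)
      fix k :: nat assume k: "k \<in> {2^J..<2^Suc J}"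
      have "real (Suc k) \<le> real (2 ^ Suc J)"
        using k by (intro of_nat_mono) auto
      then have "real k + 1 \<le> 2 ^ Suc J" by simp
      then have "(real k + 1)\<^sup>2 \<le> (2 ^ Suc J)\<^sup>2" by (intro power_mono) auto
      also have "(2 ^ Suc J :: real)\<^sup>2 = 4 ^ Suc J"
        by (simp add: power2_eq_square flip: power_mult_distrib)
      finally have "1 + (real k)\<^sup>2 \<le> 4 ^ Suc J"
        by (simp add: power2_eq_square algebra_simps)
      then show "q k / 4 ^ Suc J \<le> q k / (1 + (real k)\<^sup>2)"
        using nonneg by (intro divide_left_mono mult_pos_pos) (auto simp: add_pos_nonneg)
    qed
    moreover have "x (Suc J) = x J / 4 + (\<Sum>k=2^J..<2^Suc J. q k) / 4 ^ Suc J"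
      unfolding x_def F_def split by (simp add: add_divide_distrib)
    moreover have "(\<Sum>j<Suc J. x j) = (\<Sum>j<J. x j) + x J" by simp
    ultimately show ?case
      using Suc.IH unfolding split by argo
  qed
  have "summable x"
  proof (rule bounded_imp_summable[OF x_nonneg])
    fix J
    have "(\<Sum>j\<le>J. x j) \<le> (\<Sum>j<Suc J. x j) + 4/3 * x (Suc J)"
      using x_nonneg[of "Suc J"] by (simp add: lessThan_Suc_atMost)
    also have "\<dots> \<le> 4/3 * (\<Sum>k<2^Suc J. q k / (1 + (real k)\<^sup>2))"
      by (rule potential)
    also have "\<dots> \<le> 4/3 * (\<Sum>k. q k / (1 + (real k)\<^sup>2))"
      by (intro mult_left_mono sum_le_suminf summ) (auto simp: nonneg add_pos_nonneg)
    finally show "(\<Sum>j\<le>J. x j) \<le> 4/3 * (\<Sum>k. q k / (1 + (real k)\<^sup>2))" .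
  qed
  define D where "D j = 2 / 2 ^ j * F (Suc j)" for j
  show thesis
  proof
    show "0 \<le> D j" for j
      unfolding D_def using F_nonneg by simp
    have "D j / 2 ^ j = 8 * x (Suc j)" for j
      unfolding D_def x_def by (simp add: field_simps flip: power_mult_distrib)
    then show "summable (\<lambda>j. D j / 2 ^ j)"
      using \<open>summable x\<close> by (simp add: summable_Suc_iff summable_mult)
    fix j n :: nat assume n: "2 ^ j \<le> n" "n < 2 ^ Suc j"
    have "(\<Sum>k\<le>n. q n) \<le> (\<Sum>k\<le>n. q k + q (n - k))"
      by (rule sum_mono) (use subadd in \<open>metis atMost_iff le_add_diff_inverse\<close>)
    also have "\<dots> = 2 * (\<Sum>k\<le>n. q k)"
      using sum.nat_diff_reindex[of q "Suc n"] by (simp add: sum.distrib lessThan_Suc_atMost)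
    also have "(\<Sum>k\<le>n. q k) \<le> F (Suc j)"
      unfolding F_def using n by (intro sum_mono2) (auto simp: nonneg)
    finally have *: "(real n + 1) * q n \<le> 2 * F (Suc j)"
      by (simp add: add.commute)
    have "2 ^ j \<le> real n" using n(1) by (metis of_nat_le_iff of_nat_numeral of_nat_power)
    then have "2 ^ j * q n \<le> (real n + 1) * q n"
      by (intro mult_right_mono nonneg) linarith
    with * show "q n \<le> D j"
      unfolding D_def by (simp add: field_simps)
  qed
qed

lemma summable_exp_subadditive:
  fixes q :: "nat \<Rightarrow> real"
  assumes "\<And>n. 0 \<le> q n" and "\<And>m n. q (m + n) \<le> q m + q n"
    and "summable (\<lambda>n. q n / (1 + (real n)\<^sup>2))" and r: "0 < r" "r < 1"
  shows "summable (\<lambda>n. r ^ n * exp (q n))"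
proof -
  obtain D where D: "\<And>j. 0 \<le> D j" "\<And>j n. 2 ^ j \<le> n \<Longrightarrow> n < 2 ^ Suc j \<Longrightarrow> q n \<le> D j"
    and summD: "summable (\<lambda>j. D j / 2 ^ j)"
    using subadditive_dyadic_majorant[OF assms(1-3)] by blast
  define e where "e = - ln r / 2"
  have "e > 0" using r by (simp add: e_def)
  with summable_LIMSEQ_zero[OF summD] have "eventually (\<lambda>j. D j / 2 ^ j < e) sequentially"
    by (rule order_tendstoD(2))
  then obtain J where J: "\<And>j. j \<ge> J \<Longrightarrow> D j / 2 ^ j < e"
    by (auto simp: eventually_sequentially)
  show ?thesis
  proof (rule summable_comparison_test')
    have "exp (- e) < 1" using \<open>e > 0\<close> by simp
    then show "summable (\<lambda>n. exp (- e) ^ n)" by (intro summable_geometric) simp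
    fix n :: nat assume n: "2 ^ J \<le> n"
    then have "n > 0" using le_zero_eq by fastforce
    define j where "j = floor_log n"
    have j: "2 ^ j \<le> n" "n < 2 ^ Suc j"
      using floor_log_exp2_le[OF \<open>n > 0\<close>] floor_log_exp2_gt[of n] by (auto simp: j_def)
    have "J \<le> j" using floor_log_le_iff[OF n] by (simp add: j_def)
    have "q n \<le> D j" using D j by blast
    also have "\<dots> \<le> e * 2 ^ j" using J[OF \<open>J \<le> j\<close>] by (simp add: field_simps)
    also have "\<dots> \<le> e * real n"
      using j(1) \<open>e > 0\<close> by (metis less_eq_real_def mult_left_mono of_nat_le_iff of_nat_numeral of_nat_power)
    finally have q: "q n \<le> e * real n" .
    have "r ^ n = exp (- (2 * e * real n))"
      using r by (simp add: e_def exp_of_nat2_mult)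
    then have "r ^ n * exp (q n) = exp (q n - 2 * e * real n)"
      by (simp flip: exp_add)
    also have "\<dots> \<le> exp (- (e * real n))" using q by simp
    also have "\<dots> = exp (- e) ^ n"
      by (simp flip: exp_of_nat2_mult)
    finally show "norm (r ^ n * exp (q n)) \<le> exp (- e) ^ n" using r by simp
  qed
qed

lemma nonquasianalytic_multiplicities:
  fixes q :: "nat \<Rightarrow> real"
  assumes "\<And>n. 0 \<le> q n" and "\<And>m n. q (m + n) \<le> q m + q n"
    and "summable (\<lambda>n. q n / (1 + (real n)\<^sup>2))" and "\<delta> > 0"
  obtains m :: "nat \<Rightarrow> nat"
    where "\<And>J. (\<Sum>j<J. real (m j) * (pi / (3 * 2 ^ j))) \<le> \<delta>"
      and "summable (\<lambda>n. exp (q n) / 2 ^ m (floor_log n))"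
proof -
  obtain D where D: "\<And>j. 0 \<le> D j" "\<And>j n. 2 ^ j \<le> n \<Longrightarrow> n < 2 ^ Suc j \<Longrightarrow> q n \<le> D j"
    and summD: "summable (\<lambda>j. D j / 2 ^ j)"
    using subadditive_dyadic_majorant[OF assms(1-3)] by blast
  define k where "k j = nat \<lceil>D j / ln 2\<rceil> + 2 * j" for j
  have k_ge: "D j + 2 * real j * ln 2 \<le> real (k j) * ln 2" for j
  proof -
    have "D j / ln 2 \<le> real (nat \<lceil>D j / ln 2\<rceil>)" by linarith
    then have "D j / ln 2 * ln 2 \<le> real (nat \<lceil>D j / ln 2\<rceil>) * ln 2"
      by (intro mult_right_mono) auto
    then show ?thesis by (simp add: k_def algebra_simps)
  qed
  have k_le: "real (k j) \<le> D j / ln 2 + 1 + 2 * real j" for j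
  proof -
    have "0 \<le> D j / ln 2" using D by simp
    then have "real (nat \<lceil>D j / ln 2\<rceil>) \<le> D j / ln 2 + 1" by linarith
    then show ?thesis by (simp add: k_def)
  qed
  define e where "e j = real (k j) * (pi / (3 * 2 ^ j))" for j
  have "summable e"
  proof (rule summable_comparison_test')
    have "summable (\<lambda>j. real (Suc j) * (1/2) ^ j)"
      using geometric_deriv_sums[of "1/2 :: real"] by (auto simp: sums_iff)
    then show "summable (\<lambda>j. pi / 3 * (1 / ln 2 * (D j / 2 ^ j) + 2 * (real (Suc j) * (1/2) ^ j)))"
      by (intro summable_mult summable_add summD)
    fix j
    have "e j = pi / 3 * (real (k j) / 2 ^ j)" by (simp add: e_def)
    also have "\<dots> \<le> pi / 3 * ((D j / ln 2 + 2 * real (Suc j)) / 2 ^ j)"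
      using k_le[of j] by (intro mult_left_mono divide_right_mono) auto
    also have "\<dots> = pi / 3 * (1 / ln 2 * (D j / 2 ^ j) + 2 * (real (Suc j) * (1/2) ^ j))"
      by (simp add: add_divide_distrib power_one_over)
    finally show "norm (e j) \<le> pi / 3 * (1 / ln 2 * (D j / 2 ^ j) + 2 * (real (Suc j) * (1/2) ^ j))"
      by (simp add: e_def)
  qed
  then obtain N where N: "\<And>m n. m \<ge> N \<Longrightarrow> norm (sum e {m..<n}) < \<delta>"
    using \<open>\<delta> > 0\<close> unfolding summable_Cauchy by blast
  define m where "m j = (if j < N then 0 else k j)" for j
  show thesis
  proof
    fix J
    have "(\<Sum>j<J. real (m j) * (pi / (3 * 2 ^ j))) = sum e {N..<J}"
      by (intro sum.mono_neutral_cong_right) (auto simp: m_def e_def)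
    also have "\<dots> \<le> \<delta>" using N[of N J] by simp
    finally show "(\<Sum>j<J. real (m j) * (pi / (3 * 2 ^ j))) \<le> \<delta>" .
  next
    show "summable (\<lambda>n. exp (q n) / 2 ^ m (floor_log n))"
    proof (rule summable_comparison_test')
      show "summable (\<lambda>n. 4 * (1 / real n ^ 2))"
        by (intro summable_mult) (use inverse_power_summable[of 2, where 'a=real] in \<open>simp add: field_simps\<close>)
      fix n :: nat assume n: "2 ^ N \<le> n"
      then have "n > 0" using le_zero_eq by fastforce
      define j where "j = floor_log n"
      have j: "2 ^ j \<le> n" "n < 2 ^ Suc j"
        using floor_log_exp2_le[OF \<open>n > 0\<close>] floor_log_exp2_gt[of n] by (auto simp: j_def)
      have "N \<le> j" using floor_log_le_iff[OF n] by (simp add: j_def)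
      then have "m j = k j" by (simp add: m_def)
      have "exp (q n) * 4 ^ j \<le> exp (D j) * 4 ^ j" using D(2)[OF j] by simp
      also have "\<dots> = exp (D j + 2 * real j * ln 2)"
      proof -
        have "exp (2 * real j * ln 2) = exp (real j * ln (2 ^ 2))"
          by (simp only: ln_realpow) simp
        also have "\<dots> = 4 ^ j" by (simp add: exp_of_nat_mult)
        finally show ?thesis by (simp add: exp_add)
      qed
      also have "\<dots> \<le> exp (real (k j) * ln 2)" using k_ge by simp
      also have "\<dots> = 2 ^ k j" by (simp add: exp_of_nat_mult)
      finally have *: "exp (q n) / 2 ^ k j \<le> 1 / 4 ^ j" by (simp add: field_simps)
      have "real n < real (2 ^ Suc j)" using j(2) by (rule of_nat_less_iff[THEN iffD2])
      then have "(real n)\<^sup>2 \<le> (2 ^ Suc j)\<^sup>2" by (intro power_mono) auto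
      also have "(2 ^ Suc j :: real)\<^sup>2 = 4 * 4 ^ j"
        by (simp add: power2_eq_square flip: power_mult_distrib)
      finally have "1 / 4 ^ j \<le> 4 * (1 / real n ^ 2)" using \<open>n > 0\<close> by (simp add: field_simps)
      with * show "norm (exp (q n) / 2 ^ m (floor_log n)) \<le> 4 * (1 / real n ^ 2)"
        using \<open>m j = k j\<close> by (simp add: j_def)
    qed
  qed
qed

lemma abs_cos_dyadic_le:
  assumes "2 ^ j \<le> n" and "n < 2 ^ Suc j"
  shows "\<bar>cos (real n * (pi / (3 * 2 ^ j)))\<bar> \<le> 1 / 2"
proof -
  define x where "x = real n * (pi / (3 * 2 ^ j))"
  have "2 ^ j \<le> real n" using assms(1) by (metis of_nat_le_iff of_nat_numeral of_nat_power)
  then have lo: "pi / 3 \<le> x" unfolding x_def by (simp add: field_simps)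
  have "real n < real (2 ^ Suc j)" using assms(2) by (rule of_nat_less_iff[THEN iffD2])
  then have "real n \<le> 2 * 2 ^ j" by simp
  then have hi: "x \<le> 2 * pi / 3" unfolding x_def by (simp add: field_simps)
  have "cos x \<le> cos (pi / 3)"
    using lo hi by (intro cos_monotone_0_pi_le) auto
  moreover have "cos (pi - x) \<le> cos (pi / 3)"
    using lo hi by (intro cos_monotone_0_pi_le) auto
  ultimately show ?thesis
    by (fold x_def) (auto simp: cos_60 abs_le_iff)
qed

lemma averaged_trigonometric_series_bound:
  fixes \<alpha> \<beta> :: "nat \<Rightarrow> complex" and k :: "nat \<Rightarrow> nat" and e :: "nat \<Rightarrow> real"
  assumes "\<And>j. 0 \<le> e j"
    and "\<And>\<theta>. \<bar>\<theta>\<bar> \<le> s + (\<Sum>j<J. real (k j) * e j) \<Longrightarrow>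
      \<exists>B. (\<lambda>n. \<alpha> n * cis (- (real n * \<theta>)) + \<beta> n * cis (real n * \<theta>)) sums B \<and> cmod B \<le> \<eta>"
    and "\<bar>\<theta>\<bar> \<le> s"
  shows "\<exists>B. (\<lambda>n. complex_of_real (\<Prod>j<J. cos (real n * e j) ^ k j) *
      (\<alpha> n * cis (- (real n * \<theta>)) + \<beta> n * cis (real n * \<theta>))) sums B \<and> cmod B \<le> \<eta>"
proof -
  define Q where "Q s c \<longleftrightarrow> (\<forall>\<theta>. \<bar>\<theta>\<bar> \<le> s \<longrightarrow>
      (\<exists>B. (\<lambda>n. complex_of_real (c n) * (\<alpha> n * cis (- (real n * \<theta>)) + \<beta> n * cis (real n * \<theta>))) sums B
         \<and> cmod B \<le> \<eta>))" for s and c :: "nat \<Rightarrow> real"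
  have step: "Q s (\<lambda>n. cos (real n * d) * c n)" if Q: "Q (s + d) c" and d: "0 \<le> d" for s d c
    unfolding Q_def
  proof (intro allI impI)
    fix \<theta> :: real assume "\<bar>\<theta>\<bar> \<le> s"
    then have "\<bar>\<theta> + d\<bar> \<le> s + d" "\<bar>\<theta> - d\<bar> \<le> s + d" using d by linarith+
    then have ex: "\<exists>B. (\<lambda>n. complex_of_real (c n) * (\<alpha> n * cis (- (real n * \<theta>')) + \<beta> n * cis (real n * \<theta>'))) sums B
        \<and> cmod B \<le> \<eta>" if "\<theta>' \<in> {\<theta> + d, \<theta> - d}" for \<theta>'
      using Q that unfolding Q_def by auto
    from ex[of "\<theta> + d"] obtain B where
      B: "(\<lambda>n. complex_of_real (c n) * (\<alpha> n * cis (- (real n * (\<theta> + d))) + \<beta> n * cis (real n * (\<theta> + d)))) sums B" "cmod B \<le> \<eta>"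
      by auto
    from ex[of "\<theta> - d"] obtain C where
      C: "(\<lambda>n. complex_of_real (c n) * (\<alpha> n * cis (- (real n * (\<theta> - d))) + \<beta> n * cis (real n * (\<theta> - d)))) sums C" "cmod C \<le> \<eta>"
      by auto
    have cos_eq: "complex_of_real (cos x) * cis y = (cis (y + x) + cis (y - x)) / 2" for x y
      by (simp add: complex_eq_iff cos_add cos_diff sin_add sin_diff)
    have "complex_of_real (cos (real n * d) * c n) * (\<alpha> n * cis (- (real n * \<theta>)) + \<beta> n * cis (real n * \<theta>))
      = (complex_of_real (c n) * (\<alpha> n * cis (- (real n * (\<theta> + d))) + \<beta> n * cis (real n * (\<theta> + d)))
        + complex_of_real (c n) * (\<alpha> n * cis (- (real n * (\<theta> - d))) + \<beta> n * cis (real n * (\<theta> - d)))) / 2" for n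
    proof -
      have "complex_of_real (cos (real n * d) * c n) * (\<alpha> n * cis (- (real n * \<theta>)) + \<beta> n * cis (real n * \<theta>))
        = complex_of_real (c n) * (\<alpha> n * (complex_of_real (cos (real n * d)) * cis (- (real n * \<theta>)))
           + \<beta> n * (complex_of_real (cos (real n * d)) * cis (real n * \<theta>)))"
        by (simp add: algebra_simps)
      then show ?thesis unfolding cos_eq by (simp add: algebra_simps add_divide_distrib)
    qed
    moreover have "cmod ((B + C) / 2) \<le> \<eta>"
      using norm_triangle_ineq[of B C] B(2) C(2) by (simp add: norm_divide)
    ultimately show "\<exists>B. (\<lambda>n. complex_of_real (cos (real n * d) * c n)
        * (\<alpha> n * cis (- (real n * \<theta>)) + \<beta> n * cis (real n * \<theta>))) sums B \<and> cmod B \<le> \<eta>"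
      using sums_divide[OF sums_add[OF B(1) C(1)], of 2] by (intro exI[of _ "(B + C) / 2"]) (simp only:)
  qed
  have steps: "Q s (\<lambda>n. cos (real n * d) ^ i * c n)" if "Q (s + real i * d) c" "0 \<le> d" for s d c i
    using that(1)
  proof (induction i arbitrary: s)
    case (Suc i)
    then have "Q ((s + d) + real i * d) c" by (simp add: algebra_simps)
    then have "Q (s + d) (\<lambda>n. cos (real n * d) ^ i * c n)" by (rule Suc.IH)
    from step[OF this that(2)] show ?case by (simp add: mult.assoc)
  qed simp
  have "Q s (\<lambda>n. (\<Prod>j<J. cos (real n * e j) ^ k j) * c n)" if "Q (s + (\<Sum>j<J. real (k j) * e j)) c" for s c
    using that
  proof (induction J arbitrary: s)
    case (Suc J)
    then have "Q ((s + real (k J) * e J) + (\<Sum>j<J. real (k j) * e j)) c" by (simp add: algebra_simps)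
    then have "Q (s + real (k J) * e J) (\<lambda>n. (\<Prod>j<J. cos (real n * e j) ^ k j) * c n)" by (rule Suc.IH)
    from steps[OF this assms(1)] show ?case by (simp add: mult_ac)
  qed simp
  from this[of s "\<lambda>_. 1"] assms(2,3) show ?thesis
    unfolding Q_def by simp
qed

subsection \<open>Continuation across an arc\<close>

lemma bilateral_sequence_local_bound:
  fixes a b :: "nat \<Rightarrow> complex" and G :: "complex \<Rightarrow> complex" and m :: "nat \<Rightarrow> nat"
  assumes z: "cmod z = 1" and \<delta>: "0 < \<delta>"
    and Lip: "\<And>x y. x \<in> cball z (2 * \<delta>) \<Longrightarrow> y \<in> cball z (2 * \<delta>) \<Longrightarrow> cmod (G x - G y) \<le> L * cmod (x - y)"
    and outside: "\<And>x. x \<in> cball z (2 * \<delta>) \<Longrightarrow> 1 < cmod x \<Longrightarrow> (\<lambda>n. a n / x ^ Suc n) sums (- G x)"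
    and inside: "\<And>x. x \<in> cball z (2 * \<delta>) \<Longrightarrow> cmod x < 1 \<Longrightarrow> (\<lambda>n. b (Suc n) * x ^ n) sums G x"
    and m: "\<And>J. (\<Sum>j<J. real (m j) * (pi / (3 * 2 ^ j))) \<le> \<delta>"
    and abel: "\<And>r. 0 < r \<Longrightarrow> r < 1 \<Longrightarrow> summable (\<lambda>n. r ^ n * (cmod (a n) + cmod (b n)))"
    and summ: "summable (\<lambda>n. (cmod (a n) + cmod (b n)) / 2 ^ m (floor_log n))"
  shows "cmod (a 0) \<le> (\<Sum>n. (cmod (a (Suc n)) + cmod (b (Suc n))) / 2 ^ m (floor_log (Suc n)))"
proof -
  define s where "s n = cmod (a n) + cmod (b n)" for n
  define \<kappa> where "\<kappa> n = s n / 2 ^ m (floor_log n)" for n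
  define C where "C = cmod (G z) + 2 * \<bar>L\<bar> * \<delta> + 2 * \<bar>L\<bar>"
  have s_nonneg: "0 \<le> s n" for n by (simp add: s_def)
  define H where "H J n = (\<Prod>j<J. cos (real n * (pi / (3 * 2 ^ j))) ^ m j)" for J n
  have H_le_1: "\<bar>H J n\<bar> \<le> 1" for J n
    unfolding H_def abs_prod by (intro prod_le_1) (auto simp: power_abs power_le_one)
  have H_le: "\<bar>H J n\<bar> \<le> 1 / 2 ^ m (floor_log n)" if "0 < n" "n < 2 ^ J" for J n
  proof -
    define j where "j = floor_log n"
    have j: "2 ^ j \<le> n" "n < 2 ^ Suc j"
      using floor_log_exp2_le[OF \<open>n > 0\<close>] floor_log_exp2_gt[of n] by (auto simp: j_def)
    have "j < J" using le_less_trans[OF j(1) that(2)] by simp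
    then have "\<bar>H J n\<bar> = \<bar>cos (real n * (pi / (3 * 2 ^ j))) ^ m j\<bar> *
        (\<Prod>i\<in>{..<J} - {j}. \<bar>cos (real n * (pi / (3 * 2 ^ i))) ^ m i\<bar>)"
      unfolding H_def abs_prod by (intro prod.remove) auto
    also have "\<dots> \<le> (1 / 2) ^ m j * 1"
      using abs_cos_dyadic_le[OF j]
      by (intro mult_mono prod_le_1) (auto simp: power_abs power_le_one intro!: power_mono prod_nonneg)
    finally show ?thesis by (simp add: j_def power_one_over)
  qed
  have key: "cmod (a 0) \<le> (1 / r - r) * C + (\<Sum>n. \<kappa> (Suc n)) + e"
    if r: "0 < r" "r < 1" and r\<delta>: "1 / r - 1 \<le> \<delta>" and r2: "1 / r \<le> 2" and "0 < e" for r e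
  proof -
    define \<alpha> where "\<alpha> n = a n * complex_of_real (r ^ n) / z ^ n" for n
    define \<beta> where "\<beta> n = (if n = 0 then 0 else b n * complex_of_real (r ^ n) * z ^ n)" for n
    have B: "\<exists>B. (\<lambda>n. \<alpha> n * cis (- (real n * \<theta>)) + \<beta> n * cis (real n * \<theta>)) sums B \<and> cmod B \<le> (1 / r - r) * C"
      if \<theta>: "\<bar>\<theta>\<bar> \<le> \<delta>" for \<theta>
    proof -
      define x where "x = z * cis \<theta>"
      define \<mu> where "\<mu> = x / complex_of_real r"
      define \<nu> where "\<nu> = x * complex_of_real r"
      have x1: "cmod x = 1" using z by (simp add: x_def norm_mult)
      then have "x \<noteq> 0" by auto
      have "cmod (x - z) = cmod (z * (cis \<theta> - 1))" by (simp add: x_def right_diff_distrib)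
      also have "\<dots> = 2 * \<bar>sin (\<theta> / 2)\<bar>"
        using dist_exp_i_1[of \<theta>] z by (simp add: norm_mult cis_conv_exp)
      also have "\<dots> \<le> \<delta>" using abs_sin_x_le_abs_x[of "\<theta> / 2"] \<theta> by simp
      finally have xz: "cmod (x - z) \<le> \<delta>" .
      have "cmod (\<mu> - x) = cmod (x * complex_of_real (1 / r - 1))"
        using r by (intro arg_cong[of _ _ cmod]) (simp add: \<mu>_def field_simps)
      then have \<mu>x: "cmod (\<mu> - x) = 1 / r - 1" using r x1 by (simp only: norm_mult norm_of_real) simp
      have "cmod (\<nu> - x) = cmod (x * complex_of_real (r - 1))"
        by (intro arg_cong[of _ _ cmod]) (simp add: \<nu>_def field_simps)
      then have \<nu>x: "cmod (\<nu> - x) = 1 - r" using r x1 by (simp only: norm_mult norm_of_real) simp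
      have "1 - r \<le> 1 / r - 1"
      proof -
        have "1 - r \<le> (1 - r) / r" using r by (simp add: le_divide_eq mult_left_le)
        then show ?thesis using r by (simp add: diff_divide_distrib)
      qed
      then have mem: "\<mu> \<in> cball z (2 * \<delta>)" "\<nu> \<in> cball z (2 * \<delta>)"
        using norm_triangle_ineq[of "\<mu> - x" "x - z"] norm_triangle_ineq[of "\<nu> - x" "x - z"] \<mu>x \<nu>x xz r\<delta>
        by (auto simp: dist_norm norm_minus_commute[of z])
      have \<mu>1: "cmod \<mu> = 1 / r" and \<nu>1: "cmod \<nu> = r"
        using r x1 by (auto simp: \<mu>_def \<nu>_def norm_mult norm_divide)
      have "(\<lambda>n. \<mu> * (a n / \<mu> ^ Suc n)) sums (\<mu> * (- G \<mu>))"
        using outside[OF mem(1)] \<mu>1 r by (intro sums_mult) simp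
      moreover have "\<mu> * (a n / \<mu> ^ Suc n) = \<alpha> n * cis (- (real n * \<theta>))" for n
      proof -
        have "cis (- (real n * \<theta>)) = inverse (cis \<theta> ^ n)" by (simp only: Complex.DeMoivre cis_inverse)
        then have "\<alpha> n * cis (- (real n * \<theta>)) = a n / \<mu> ^ n"
          by (simp add: \<alpha>_def \<mu>_def x_def power_divide power_mult_distrib divide_simps)
        moreover have "\<mu> \<noteq> 0" using r \<open>x \<noteq> 0\<close> by (simp add: \<mu>_def)
        ultimately show ?thesis by simp
      qed
      ultimately have 1: "(\<lambda>n. \<alpha> n * cis (- (real n * \<theta>))) sums (- (\<mu> * G \<mu>))" by simp
      have "(\<lambda>n. \<nu> * (b (Suc n) * \<nu> ^ n)) sums (\<nu> * G \<nu>)"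
        using inside[OF mem(2)] \<nu>1 r by (intro sums_mult) simp
      moreover have "\<nu> * (b (Suc n) * \<nu> ^ n) = \<beta> (Suc n) * cis (real (Suc n) * \<theta>)" for n
        unfolding Complex.DeMoivre[symmetric] by (simp add: \<beta>_def \<nu>_def x_def power_mult_distrib mult_ac)
      ultimately have "(\<lambda>n. \<beta> (Suc n) * cis (real (Suc n) * \<theta>)) sums (\<nu> * G \<nu>)" by simp
      then have 2: "(\<lambda>n. \<beta> n * cis (real n * \<theta>)) sums (\<nu> * G \<nu>)"
        by (subst (asm) sums_Suc_iff) (simp add: \<beta>_def)
      have "cmod (- (\<mu> * G \<mu>) + \<nu> * G \<nu>) = cmod ((\<nu> - \<mu>) * G \<nu> + \<mu> * (G \<nu> - G \<mu>))"
        by (simp add: algebra_simps)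
      also have "\<dots> \<le> cmod (\<nu> - \<mu>) * cmod (G \<nu>) + cmod \<mu> * cmod (G \<nu> - G \<mu>)"
        by (rule norm_triangle_le) (simp add: norm_mult)
      also have "\<dots> \<le> (1 / r - r) * C"
      proof -
        have dist: "cmod (\<nu> - \<mu>) \<le> 1 / r - r"
          using norm_triangle_ineq[of "\<nu> - x" "x - \<mu>"] \<mu>x \<nu>x by (simp add: norm_minus_commute[of x])
        have "cmod (G \<nu> - G z) \<le> L * cmod (\<nu> - z)"
          using mem \<delta> by (intro Lip) auto
        also have "\<dots> \<le> \<bar>L\<bar> * (2 * \<delta>)"
          using mem by (intro mult_mono) (auto simp: dist_norm norm_minus_commute)
        finally have "cmod (G \<nu>) \<le> cmod (G z) + 2 * \<bar>L\<bar> * \<delta>"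
          using norm_triangle_ineq[of "G \<nu> - G z" "G z"] by simp
        then have "cmod (\<nu> - \<mu>) * cmod (G \<nu>) \<le> (1 / r - r) * (cmod (G z) + 2 * \<bar>L\<bar> * \<delta>)"
          using dist norm_ge_zero[of "\<nu> - \<mu>"] by (intro mult_mono) (linarith | rule norm_ge_zero)+
        moreover have "cmod (G \<nu> - G \<mu>) \<le> \<bar>L\<bar> * (1 / r - r)"
          by (rule order_trans[OF Lip[OF mem(2,1)]]) (use dist in \<open>auto intro!: mult_mono\<close>)
        then have "cmod \<mu> * cmod (G \<nu> - G \<mu>) \<le> 2 * (\<bar>L\<bar> * (1 / r - r))"
          using r2 \<mu>1 by (intro mult_mono) auto
        ultimately show ?thesis by (simp add: C_def algebra_simps)
      qed
      finally show ?thesis using sums_add[OF 1 2] by blast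
    qed
    have summr: "summable (\<lambda>n. r ^ n * s n)" unfolding s_def by (rule abel) (use r in auto)
    obtain N where N: "\<And>M. M \<ge> N \<Longrightarrow> norm (\<Sum>n. r ^ (n + M) * s (n + M)) < e"
      using suminf_exist_split[OF \<open>0 < e\<close> summr] by blast
    define J where "J = N"
    have "N \<le> 2 ^ J" by (simp add: J_def less_imp_le)
    obtain B where sumsB: "(\<lambda>n. complex_of_real (H J n) * (\<alpha> n + \<beta> n)) sums B" and Ble: "cmod B \<le> (1 / r - r) * C"
    proof -
      have "\<exists>B. (\<lambda>n. complex_of_real (H J n) * (\<alpha> n * cis (- (real n * 0)) + \<beta> n * cis (real n * 0))) sums B
          \<and> cmod B \<le> (1 / r - r) * C"
        unfolding H_def
        by (rule averaged_trigonometric_series_bound[where s = 0])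
          (use m[of J] in \<open>auto intro!: B elim: order_trans\<close>)
      then show thesis using that by auto
    qed
    define t where "t n = complex_of_real (H J n) * (\<alpha> n + \<beta> n)" for n
    have t0: "t 0 = a 0" by (simp add: t_def H_def \<alpha>_def \<beta>_def)
    define u where "u n = (if n < 2 ^ J then 0 else r ^ n * s n)" for n
    have u_nonneg: "0 \<le> u n" for n using r s_nonneg by (simp add: u_def)
    have t_le: "cmod (t (Suc n)) \<le> \<kappa> (Suc n) + u (Suc n)" for n
    proof -
      have "cmod (\<alpha> (Suc n) + \<beta> (Suc n)) \<le> r ^ Suc n * s (Suc n)"
        using r z by (intro norm_triangle_le)
          (simp add: \<alpha>_def \<beta>_def s_def norm_mult norm_divide norm_power algebra_simps)
      then have le: "cmod (t (Suc n)) \<le> \<bar>H J (Suc n)\<bar> * (r ^ Suc n * s (Suc n))"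
        by (simp add: t_def norm_mult mult_left_mono)
      show ?thesis
      proof (cases "Suc n < 2 ^ J")
        case True
        have "r ^ Suc n * s (Suc n) \<le> s (Suc n)"
          using r s_nonneg power_le_one[of r "Suc n"] by (intro mult_left_le_one_le) auto
        then have "\<bar>H J (Suc n)\<bar> * (r ^ Suc n * s (Suc n)) \<le> 1 / 2 ^ m (floor_log (Suc n)) * s (Suc n)"
          using r s_nonneg H_le[OF _ True] by (intro mult_mono) auto
        with le True show ?thesis by (simp add: u_def \<kappa>_def)
      next
        case False
        have "\<bar>H J (Suc n)\<bar> * (r ^ Suc n * s (Suc n)) \<le> r ^ Suc n * s (Suc n)"
          using r s_nonneg H_le_1 by (intro mult_left_le_one_le) auto
        moreover have "0 \<le> \<kappa> (Suc n)" using s_nonneg by (simp add: \<kappa>_def)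
        ultimately show ?thesis using le False by (simp add: u_def)
      qed
    qed
    have summu: "summable u"
      by (rule summable_comparison_test'[OF summr, where N=0]) (use r s_nonneg in \<open>auto simp: u_def\<close>)
    have summ\<kappa>: "summable (\<lambda>n. \<kappa> (Suc n))"
      using summ summable_Suc_iff[of \<kappa>] by (simp add: \<kappa>_def[abs_def] s_def)
    have "(\<Sum>n<2^J. u n) = 0" by (simp add: u_def)
    then have "(\<Sum>n. u n) = (\<Sum>n. u (n + 2 ^ J))"
      using suminf_split_initial_segment[OF summu, of "2 ^ J"] by simp
    also have "\<dots> = (\<Sum>n. r ^ (n + 2 ^ J) * s (n + 2 ^ J))" by (simp add: u_def)
    also have "\<dots> \<le> e" using N[OF \<open>N \<le> 2 ^ J\<close>] by simp
    finally have ue: "(\<Sum>n. u (Suc n)) \<le> e"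
      using suminf_split_head[OF summu] u_nonneg[of 0] by simp
    have "t sums B" using sumsB by (simp add: t_def[abs_def])
    then have "(\<lambda>n. t (Suc n)) sums (B - a 0)"
      using t0 by (subst sums_Suc_iff) simp
    then have "cmod (B - a 0) = cmod (\<Sum>n. t (Suc n))" by (simp add: sums_iff)
    also have "\<dots> \<le> (\<Sum>n. \<kappa> (Suc n) + u (Suc n))"
      using summ\<kappa> summu t_le by (intro norm_suminf_le summable_add) (auto simp: summable_Suc_iff)
    also have "\<dots> = (\<Sum>n. \<kappa> (Suc n)) + (\<Sum>n. u (Suc n))"
      using summ\<kappa> summu by (intro suminf_add[symmetric]) (auto simp: summable_Suc_iff)
    finally show ?thesis
      using ue Ble norm_triangle_ineq4[of B "B - a 0"] by simp
  qed
  have "((\<lambda>r. (1 / r - r) * C + (\<Sum>n. \<kappa> (Suc n)) + (1 - r)) \<longlongrightarrow> (1 / 1 - 1) * C + (\<Sum>n. \<kappa> (Suc n)) + (1 - 1)) (at_left 1)"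
    by (intro tendsto_intros) auto
  moreover have "eventually (\<lambda>r. cmod (a 0) \<le> (1 / r - r) * C + (\<Sum>n. \<kappa> (Suc n)) + (1 - r)) (at_left 1)"
  proof -
    have lim: "((\<lambda>r::real. 1 / r) \<longlongrightarrow> 1 / 1) (at_left 1)" by (intro tendsto_intros) auto
    have "eventually (\<lambda>r::real. r \<in> {0<..<1}) (at_left 1)"
      by (rule eventually_at_leftI[of 0]) auto
    moreover have "eventually (\<lambda>r::real. 1 / r < 1 + \<delta>) (at_left 1)"
      "eventually (\<lambda>r::real. 1 / r < 2) (at_left 1)"
      using \<delta> by (intro order_tendstoD(2)[OF lim]; simp)+
    ultimately show ?thesis
      by eventually_elim (auto intro!: key)
  qed
  ultimately show ?thesis
    by (intro tendsto_lowerbound[of _ _ "at_left (1::real)"]) (auto simp: \<kappa>_def s_def)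
qed

subsection \<open>Characters and the Shilov boundary\<close>

locale semisimple_banach_algebra =
  fixes sc :: "complex \<Rightarrow> 'a::{banach,real_normed_algebra_1,comm_ring_1} \<Rightarrow> 'a"
  assumes complex_banach_algebra: "complex_banach_algebra sc"
    and semisimple: "semisimple sc"
begin

abbreviation "M \<equiv> max_ideal_space sc"
abbreviation "Sh \<equiv> shilov_boundary sc"

lemma sc_add_left: "sc (c + d) x = sc c x + sc d x"
  and sc_add_right: "sc c (x + y) = sc c x + sc c y"
  and norm_sc: "norm (sc c x) = cmod c * norm x"
  and sc_mult_left: "sc c x * y = sc c (x * y)"
  using complex_banach_algebra unfolding complex_banach_algebra_def by auto

lemma sc_zero_right [simp]: "sc c 0 = 0"
  using sc_add_right[of c 0 0] by simp

lemma sc_minus_right: "sc c (- x) = - sc c x"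
  using sc_add_right[of c x "- x"] by (simp add: eq_neg_iff_add_eq_0 add.commute)

lemma sc_diff_right: "sc c (x - y) = sc c x - sc c y"
  using sc_add_right[of c x "- y"] by (simp add: sc_minus_right)

lemma sc_diff_left: "sc (c - d) x = sc c x - sc d x"
  using sc_add_left[of "c - d" d x] by simp

lemma sc_mult_right: "x * sc c y = sc c (x * y)"
  by (metis mult.commute sc_mult_left)

context
  fixes t assumes t: "t \<in> M"
begin

lemma char_1 [simp]: "t 1 = 1"
  and char_mult [simp]: "t (x * y) = t x * t y"
  and char_add [simp]: "t (x + y) = t x + t y"
  and char_sc [simp]: "t (sc c x) = c * t x"
  using t unfolding max_ideal_space_def is_character_def by auto

lemma char_0 [simp]: "t 0 = 0"
  using char_add[of 0 0] by simp

lemma char_minus [simp]: "t (- x) = - t x"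
  using char_add[of x "- x"] by (simp add: eq_neg_iff_add_eq_0 add.commute)

lemma char_diff [simp]: "t (x - y) = t x - t y"
  using char_add[of x "- y"] by simp

lemma char_power [simp]: "t (x ^ n) = t x ^ n"
  by (induction n) auto

lemma char_le_norm: "cmod (t x) \<le> norm x"
proof (rule ccontr)
  assume "\<not> ?thesis"
  then have less: "norm x < cmod (t x)" by simp
  then have nz: "t x \<noteq> 0" using norm_ge_zero[of x] by auto
  define y where "y = sc (inverse (t x)) x"
  have "norm y < 1" using less nz by (simp add: y_def norm_sc inverse_eq_divide norm_divide)
  then have "summable (\<lambda>n. y ^ n)" by (rule complete_algebra_summable_geometric)
  then obtain s where s: "(\<lambda>n. y ^ n) sums s" by blast
  have "(\<lambda>n. y * y ^ n) sums (y * s)" by (rule sums_mult[OF s])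
  moreover have "(\<lambda>n. y * y ^ n) sums (s - 1)"
    using s sums_Suc_iff[of "\<lambda>n. y ^ n" "s - 1"] by simp
  ultimately have "s - 1 = y * s" by (rule sums_unique2[symmetric])
  then have "t (s - 1) = t (y * s)" by simp
  then show False using nz by (simp add: y_def)
qed

end

lemma semisimpleD: "(\<And>t. t \<in> M \<Longrightarrow> t x = 0) \<Longrightarrow> x = 0"
  using semisimple unfolding semisimple_def by blast

lemma max_ideal_space_nonempty: "M \<noteq> {}"
  using semisimpleD[of 1] by auto

lemma gelfand_topology_eq: "gelfand_topology sc = top_of_set M"
  unfolding gelfand_topology_def euclidean_product_topology ..

lemma closed_max_ideal_space: "closed M"
proof -
  have "M = {t. t 1 = 1} \<inter> {t. \<forall>x y. t (x * y) = t x * t y} \<inter>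
      {t. \<forall>x y. t (x + y) = t x + t y} \<inter> {t. \<forall>c x. t (sc c x) = c * t x}"
    unfolding max_ideal_space_def is_character_def by auto
  also have "closed \<dots>"
    by (intro closed_Int closed_Collect_all closed_Collect_eq continuous_on_add continuous_on_mult
        continuous_on_product_coordinates continuous_on_const)
  finally show ?thesis .
qed

lemma compact_max_ideal_space: "compact M"
proof -
  have "compactin (product_topology (\<lambda>_. euclidean) UNIV) (PiE UNIV (\<lambda>x::'a. cball (0::complex) (norm x)))"
    unfolding compactin_PiE by simp
  then have "compact (PiE UNIV (\<lambda>x::'a. cball (0::complex) (norm x)))"
    by (simp add: euclidean_product_topology)
  then have "compact (PiE UNIV (\<lambda>x::'a. cball (0::complex) (norm x)) \<inter> M)"
    using closed_max_ideal_space by (rule compact_Int_closed)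
  moreover have "M \<subseteq> PiE UNIV (\<lambda>x::'a. cball (0::complex) (norm x))"
    using char_le_norm by auto
  ultimately show ?thesis by (simp add: Int_absorb1)
qed

lemma closedin_gelfand_iff: "closedin (gelfand_topology sc) B \<longleftrightarrow> closed B \<and> B \<subseteq> M"
  unfolding gelfand_topology_eq
  using closed_max_ideal_space closedin_closed_eq by blast

lemma gelfand_attains_max:
  assumes "closed B" and "B \<subseteq> M" and "B \<noteq> {}"
  obtains t where "t \<in> B" and "\<And>s. s \<in> B \<Longrightarrow> cmod (s x) \<le> cmod (t x)"
proof -
  have "compact B"
    using compact_Int_closed[OF compact_max_ideal_space assms(1)] assms(2) by (simp add: Int_absorb1)
  moreover have "continuous_on B (\<lambda>t. cmod (t x))"
    by (intro continuous_on_norm continuous_on_subset[OF continuous_on_product_coordinates]) simp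
  ultimately show thesis
    using continuous_attains_sup[of B "\<lambda>t. cmod (t x)"] assms(3) that by blast
qed

lemma is_boundary_max_ideal_space: "is_boundary sc M"
  unfolding is_boundary_def
  using gelfand_attains_max[OF closed_max_ideal_space _ max_ideal_space_nonempty] by (metis order_refl)

lemma not_boundary_imp_peak:
  assumes C: "closed C" "C \<subseteq> M" and neg: "\<not> is_boundary sc C" and "0 < \<epsilon>"
  obtains g where "\<And>t. t \<in> M \<Longrightarrow> cmod (t g) \<le> 1" and "\<And>s. s \<in> C \<Longrightarrow> cmod (s g) < \<epsilon>"
    and "\<exists>t\<in>M. cmod (t g) = 1"
proof -
  obtain f where f: "\<And>s. s \<in> C \<Longrightarrow> \<exists>t\<in>M. cmod (s f) < cmod (t f)"
    using neg C unfolding is_boundary_def by (auto simp: not_le)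
  obtain p where p: "p \<in> M" "\<And>t. t \<in> M \<Longrightarrow> cmod (t f) \<le> cmod (p f)"
    using gelfand_attains_max[OF closed_max_ideal_space order_refl max_ideal_space_nonempty, of f] by blast
  show thesis
  proof (cases "C = {}")
    case True
    then show thesis using that[of 1] max_ideal_space_nonempty by auto
  next
    case False
    obtain c where c: "c \<in> C" "\<And>s. s \<in> C \<Longrightarrow> cmod (s f) \<le> cmod (c f)"
      using gelfand_attains_max[OF C False, of f] by blast
    have cp: "cmod (c f) < cmod (p f)" using f[OF c(1)] p(2) by force
    then have pf: "cmod (p f) > 0" by (metis norm_ge_zero order_le_less_trans)
    define \<kappa> where "\<kappa> = cmod (c f) / cmod (p f)"
    have "0 \<le> \<kappa>" "\<kappa> < 1" using cp pf by (auto simp: \<kappa>_def)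
    then obtain n where n: "\<kappa> ^ n < \<epsilon>"
      using \<open>0 < \<epsilon>\<close> real_arch_pow_inv by blast
    define g where "g = sc (1 / p f) f ^ n"
    have g: "cmod (t g) = (cmod (t f) / cmod (p f)) ^ n" if "t \<in> M" for t
      using that by (simp add: g_def norm_power norm_divide norm_mult)
    show thesis
    proof (rule that[of g])
      show "cmod (t g) \<le> 1" if "t \<in> M" for t
        using g[OF that] p(2)[OF that] pf by (simp add: power_le_one)
      show "cmod (s g) < \<epsilon>" if "s \<in> C" for s
      proof -
        have "cmod (s g) \<le> \<kappa> ^ n"
          using c(2)[OF that] pf unfolding g[OF subsetD[OF C(2) that]] \<kappa>_def
          by (intro power_mono divide_right_mono) auto
        then show ?thesis using n by simp
      qed
      show "\<exists>t\<in>M. cmod (t g) = 1" using g[OF p(1)] p(1) pf by (intro bexI[of _ p]) auto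
    qed
  qed
qed

text \<open>If E - V is not a boundary, some g peaks off E - V with small values there; then g times any
  defining function of V stays below 1 on E, hence everywhere, so g can only peak inside V.\<close>
lemma is_boundary_diff_basic_open:
  assumes E: "is_boundary sc E" "closed E" and F: "is_boundary sc F"
    and I: "finite I" and V: "V = {t. \<forall>x\<in>I. cmod (t x) < 1}" "open V" and FV: "F \<inter> V = {}"
  shows "is_boundary sc (E - V)"
proof (rule ccontr)
  assume neg: "\<not> is_boundary sc (E - V)"
  have EM: "E \<subseteq> M" and FM: "F \<subseteq> M" using E F by (auto simp: is_boundary_def)
  define \<epsilon> where "\<epsilon> = 1 / (1 + (\<Sum>x\<in>I. norm x))"
  have "\<epsilon> > 0" unfolding \<epsilon>_def by (simp add: add_pos_nonneg sum_nonneg)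
  obtain g where g: "\<And>t. t \<in> M \<Longrightarrow> cmod (t g) \<le> 1" "\<And>s. s \<in> E - V \<Longrightarrow> cmod (s g) < \<epsilon>"
    "\<exists>t\<in>M. cmod (t g) = 1"
  proof (rule not_boundary_imp_peak[OF _ _ neg \<open>\<epsilon> > 0\<close>])
    show "closed (E - V)" using E V by (simp add: closed_Diff)
  qed (use EM in auto)
  have small: "cmod (s (g * x)) < 1" if "s \<in> E" "x \<in> I" for s x
  proof (cases "s \<in> V")
    case True
    have "s \<in> M" using EM that by blast
    then have "cmod (s g) * cmod (s x) \<le> cmod (s x)" using g(1) by (intro mult_left_le_one_le) auto
    also have "\<dots> < 1" using True that V by blast
    finally show ?thesis using \<open>s \<in> M\<close> by (simp add: norm_mult)
  next
    case False
    have "s \<in> M" using EM that by blast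
    have "norm x \<le> (\<Sum>x\<in>I. norm x)" using I that by (intro member_le_sum) auto
    then have "cmod (s x) < 1 + (\<Sum>x\<in>I. norm x)" using char_le_norm[OF \<open>s \<in> M\<close>, of x] by linarith
    then have "cmod (s x) * \<epsilon> < 1" unfolding \<epsilon>_def by (simp add: field_simps add_pos_nonneg sum_nonneg)
    moreover have "cmod (s g) * cmod (s x) \<le> \<epsilon> * cmod (s x)"
      using g(2)[of s] False that by (intro mult_right_mono) auto
    ultimately show ?thesis using \<open>s \<in> M\<close> by (simp add: norm_mult mult.commute)
  qed
  obtain p where p: "p \<in> F" "\<And>t. t \<in> M \<Longrightarrow> cmod (t g) \<le> cmod (p g)"
    using F unfolding is_boundary_def by blast
  have pM: "p \<in> M" using p FM by blast
  have "cmod (p g) = 1" using p(2) g(1)[OF pM] g(3) by force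
  have "cmod (p x) < 1" if "x \<in> I" for x
  proof -
    obtain s where "s \<in> E" "cmod (p (g * x)) \<le> cmod (s (g * x))"
      using E(1) pM unfolding is_boundary_def by blast
    with small[OF _ that] have "cmod (p (g * x)) < 1" by fastforce
    then show ?thesis using pM \<open>cmod (p g) = 1\<close> by (simp add: norm_mult)
  qed
  then have "p \<in> V" by (simp add: V)
  then show False using p FV by blast
qed

lemma basic_neighbourhood_avoiding_closed:
  assumes "closed B" and "t \<notin> B" and "t \<in> M"
  obtains I V where "finite I" and "V = {s. \<forall>x\<in>I. cmod (s x) < 1}" and "open V" and "t \<in> V"
    and "B \<inter> M \<inter> V = {}"
proof -
  have "openin (product_topology (\<lambda>_::'a. euclidean::complex topology) UNIV) (- B)"
    unfolding euclidean_product_topology using assms(1) by (simp add: open_Compl)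
  then obtain X where X: "t \<in> PiE UNIV X" "\<And>i. openin euclidean (X i)"
      "finite {i. X i \<noteq> topspace euclidean}" "PiE UNIV X \<subseteq> - B"
    using product_topology_open_contains_basis[of "\<lambda>_::'a. euclidean::complex topology" UNIV "- B" t] assms(2) by auto
  define Y where "Y = {i. X i \<noteq> UNIV}"
  have "finite Y" using X(3) by (simp add: Y_def)
  have "\<exists>d>0. ball (t i) d \<subseteq> X i" for i
    using X(1) X(2)[of i] by (auto simp: open_contains_ball)
  then obtain d where d: "\<And>i. d i > 0" "\<And>i. ball (t i) (d i) \<subseteq> X i" by metis
  define y where "y i = sc (complex_of_real (1 / d i)) (i - sc (t i) 1)" for i
  have y: "cmod (s (y i)) = cmod (s i - t i) / d i" if "s \<in> M" for s i
    using that d(1)[of i] by (simp add: y_def norm_mult norm_divide)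
  define V where "V = {s. \<forall>x\<in>y ` Y. cmod (s x) < 1}"
  show thesis
  proof
    show "finite (y ` Y)" using \<open>finite Y\<close> by simp
    show "V = {s. \<forall>x\<in>y ` Y. cmod (s x) < 1}" by (fact V_def)
    have "V = (\<Inter>x\<in>y ` Y. {s. cmod (s x) < 1})" by (auto simp: V_def)
    also have "open \<dots>"
      using \<open>finite Y\<close> by (intro open_INT ballI open_Collect_less continuous_on_norm
        continuous_on_product_coordinates continuous_on_const) auto
    finally show "open V" .
    show "t \<in> V" using y[OF assms(3)] by (simp add: V_def)
    show "B \<inter> M \<inter> V = {}"
    proof (rule ccontr)
      assume "B \<inter> M \<inter> V \<noteq> {}"
      then obtain s where s: "s \<in> B" "s \<in> M" "s \<in> V" by blast
      have "s i \<in> X i" for i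
      proof (cases "i \<in> Y")
        case True
        then have "cmod (s i - t i) < d i" using s y[of s i] d(1)[of i] by (auto simp: V_def)
        then show ?thesis using d(2)[of i] by (auto simp: dist_norm norm_minus_commute)
      qed (simp add: Y_def)
      then have "s \<in> PiE UNIV X" by auto
      then show False using X(4) s by blast
    qed
  qed
qed

lemma is_boundary_shilov: "is_boundary sc Sh"
  unfolding is_boundary_def
proof (intro conjI allI)
  show "Sh \<subseteq> M"
    unfolding shilov_boundary_def closedin_gelfand_iff
    using is_boundary_max_ideal_space closed_max_ideal_space by blast
  fix f
  define K where "K = {t \<in> M. \<forall>s\<in>M. cmod (s f) \<le> cmod (t f)}"
  show "\<exists>t\<in>Sh. \<forall>m\<in>M. cmod (m f) \<le> cmod (t f)"
  proof (rule ccontr)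
    assume neg: "\<not> ?thesis"
    have "\<exists>V. open V \<and> t \<in> V \<and> (\<forall>E. is_boundary sc E \<longrightarrow> closed E \<longrightarrow> is_boundary sc (E - V))" if "t \<in> K" for t
    proof -
      have "t \<in> M" using that by (simp add: K_def)
      have "t \<notin> Sh" using neg that by (auto simp: K_def)
      then obtain B where B: "is_boundary sc B" "closed B" "B \<subseteq> M" "t \<notin> B"
        unfolding shilov_boundary_def closedin_gelfand_iff by blast
      obtain I V where "finite I" "V = {s. \<forall>x\<in>I. cmod (s x) < 1}" "open V" "t \<in> V" "B \<inter> M \<inter> V = {}"
        using basic_neighbourhood_avoiding_closed[OF B(2,4) \<open>t \<in> M\<close>] by blast
      moreover from this have "B \<inter> V = {}" using B(3) by blast
      ultimately show ?thesis using is_boundary_diff_basic_open B(1) by blast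
    qed
    then obtain V where V: "\<And>t. t \<in> K \<Longrightarrow> open (V t) \<and> t \<in> V t"
      "\<And>t E. t \<in> K \<Longrightarrow> is_boundary sc E \<Longrightarrow> closed E \<Longrightarrow> is_boundary sc (E - V t)"
      by metis
    have "K = M \<inter> (\<Inter>s\<in>M. {t. cmod (s f) \<le> cmod (t f)})" by (auto simp: K_def)
    moreover have "closed (\<Inter>s\<in>M. {t. cmod (s f) \<le> cmod (t f)})"
      by (intro closed_INT ballI closed_Collect_le continuous_on_norm
        continuous_on_product_coordinates continuous_on_const)
    ultimately have "compact K"
      using compact_Int_closed[OF compact_max_ideal_space] by simp
    then obtain T where T: "T \<subseteq> K" "finite T" "K \<subseteq> (\<Union>t\<in>T. V t)"
      using V(1) by (elim compactE_image[where C=K and f=V]) auto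
    have "is_boundary sc (M - (\<Union>t\<in>T'. V t)) \<and> closed (M - (\<Union>t\<in>T'. V t))" if "T' \<subseteq> T" for T'
      using finite_subset[OF that T(2)] that
    proof (induction T' rule: finite_induct)
      case empty
      then show ?case using is_boundary_max_ideal_space closed_max_ideal_space by simp
    next
      case (insert t T')
      have eq: "M - (\<Union>t\<in>insert t T'. V t) = M - (\<Union>t\<in>T'. V t) - V t" by blast
      have "t \<in> K" using insert.prems T(1) by blast
      then show ?case
        unfolding eq using insert V by (auto intro: closed_Diff)
    qed
    then have "is_boundary sc (M - (\<Union>t\<in>T. V t))" by blast
    then obtain t where "t \<in> M - (\<Union>t\<in>T. V t)" "\<forall>m\<in>M. cmod (m f) \<le> cmod (t f)"
      unfolding is_boundary_def by blast
    then show False using T(3) by (auto simp: K_def)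
  qed
qed

lemma shilov_boundary_peak:
  assumes "t \<in> Sh" and "open V" and "t \<in> V" and "0 < \<epsilon>"
  obtains g s where "s \<in> Sh" and "s \<in> V" and "s g = 1" and "\<And>x. x \<in> M \<Longrightarrow> cmod (x g) \<le> 1"
    and "\<And>x. x \<in> M \<Longrightarrow> x \<notin> V \<Longrightarrow> cmod (x g) < \<epsilon>"
proof -
  have closed: "closed (M - V)" using closed_max_ideal_space assms(2) by (simp add: closed_Diff)
  have "\<not> is_boundary sc (M - V)"
    using assms(1,3) closed unfolding shilov_boundary_def closedin_gelfand_iff by blast
  from not_boundary_imp_peak[OF closed _ this, of "min \<epsilon> 1"] assms(4) obtain g
    where g: "\<And>t. t \<in> M \<Longrightarrow> cmod (t g) \<le> 1" "\<And>s. s \<in> M - V \<Longrightarrow> cmod (s g) < min \<epsilon> 1"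
    and "\<exists>t\<in>M. cmod (t g) = 1"
    by auto
  moreover obtain s where s: "s \<in> Sh" "\<And>t. t \<in> M \<Longrightarrow> cmod (t g) \<le> cmod (s g)"
    using is_boundary_shilov unfolding is_boundary_def by blast
  moreover have "s \<in> M" using s(1) is_boundary_shilov by (auto simp: is_boundary_def)
  ultimately have sg: "cmod (s g) = 1" by force
  then have "s \<in> V" using g(2)[of s] \<open>s \<in> M\<close> by force
  define g' where "g' = sc (1 / s g) g"
  have "s g \<noteq> 0" using sg by auto
  have norm_g': "cmod (x g') = cmod (x g)" if "x \<in> M" for x
    using that sg by (simp add: g'_def norm_mult norm_divide)
  show thesis
  proof (rule that[OF s(1) \<open>s \<in> V\<close>, of g'])
    show "s g' = 1" using \<open>s \<in> M\<close> \<open>s g \<noteq> 0\<close> by (simp add: g'_def)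
  qed (use norm_g' g in force)+
qed

lemma shilov_subset: "Sh \<subseteq> M"
  using is_boundary_shilov by (simp add: is_boundary_def)

lemma shilov_nonempty: "Sh \<noteq> {}"
  using is_boundary_shilov by (auto simp: is_boundary_def)

lemma semisimple_shilov:
  assumes "\<And>t. t \<in> Sh \<Longrightarrow> t x = 0"
  shows "x = 0"
proof (rule semisimpleD)
  fix m assume "m \<in> M"
  then obtain t where "t \<in> Sh" "cmod (m x) \<le> cmod (t x)"
    using is_boundary_shilov unfolding is_boundary_def by blast
  with assms show "m x = 0" by force
qed

definition gnorm :: "'a \<Rightarrow> real" where
  "gnorm x = (SUP t\<in>Sh. cmod (t x))"

lemma bdd_above_shilov: "bdd_above ((\<lambda>t. cmod (t x)) ` Sh)"
  using char_le_norm shilov_subset by (intro bdd_aboveI[of _ "norm x"]) auto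

lemma char_le_gnorm: "t \<in> Sh \<Longrightarrow> cmod (t x) \<le> gnorm x"
  unfolding gnorm_def by (rule cSUP_upper[OF _ bdd_above_shilov])

lemma gnorm_leI: "(\<And>t. t \<in> Sh \<Longrightarrow> cmod (t x) \<le> c) \<Longrightarrow> gnorm x \<le> c"
  unfolding gnorm_def by (rule cSUP_least[OF shilov_nonempty])

lemma check_algebra_le_sup_norm:
  assumes "g \<in> check_algebra sc" and "t \<in> Sh"
  shows "cmod (g t) \<le> sup_norm sc g"
proof -
  obtain f where f: "\<And>t. t \<in> Sh \<Longrightarrow> cmod (g t - t f) < 1"
    using assms(1) zero_less_one unfolding check_algebra_def by blast
  have "cmod (g s) \<le> norm f + 1" if "s \<in> Sh" for s
    using f[OF that] norm_triangle_ineq[of "g s - s f" "s f"] char_le_norm[of s f] shilov_subset that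
    by force
  then have "bdd_above ((\<lambda>t. cmod (g t)) ` Sh)" by (intro bdd_aboveI[of _ "norm f + 1"]) auto
  then show ?thesis unfolding sup_norm_def by (intro cSUP_upper assms(2))
qed

lemma restrict_1_in_check_algebra: "restrict (\<lambda>_. 1) Sh \<in> check_algebra sc"
  using shilov_subset unfolding check_algebra_def by (auto intro!: exI[of _ 1])

end

subsection \<open>Weighted automorphisms\<close>

locale weighted_automorphism = semisimple_banach_algebra +
  fixes U :: "'a \<Rightarrow> 'a" and w :: 'a
  assumes automorphism: "algebra_automorphism sc U"
    and invertible: "\<exists>v. w * v = 1"
begin

definition T :: "'a \<Rightarrow> 'a" where "T f = w * U f"

lemma bij_U: "bij U"
  and U_1 [simp]: "U 1 = 1"
  and U_add: "U (x + y) = U x + U y"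
  and U_mult: "U (x * y) = U x * U y"
  and U_sc: "U (sc c x) = sc c (U x)"
  using automorphism unfolding algebra_automorphism_def by auto

lemma U_diff: "U (x - y) = U x - U y"
  using U_add[of "x - y" y] by simp

lemma automorphism_inv: "algebra_automorphism sc (inv U)"
proof -
  have inv_eq: "inv U y = x" if "U x = y" for x y
    using that bij_U by (auto simp: bij_is_inj)
  have UU: "U (inv U x) = x" for x
    using bij_U by (simp add: bij_is_surj surj_f_inv_f)
  show ?thesis
    unfolding algebra_automorphism_def
    using bij_imp_bij_inv[OF bij_U] by (auto intro!: inv_eq simp: U_add U_mult U_sc UU)
qed

lemma char_comp_U: "t \<in> M \<Longrightarrow> t \<circ> U \<in> M"
  unfolding max_ideal_space_def is_character_def by (simp add: U_add U_mult U_sc)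

lemma shilov_comp_U:
  assumes "t \<in> Sh"
  shows "t \<circ> U \<in> Sh"
  unfolding shilov_boundary_def closedin_gelfand_iff
proof (intro InterI, elim CollectE conjE)
  fix B assume B: "is_boundary sc B" "closed B" "B \<subseteq> M"
  define B' where "B' = M \<inter> {m. m \<circ> U \<in> B}"
  have "continuous_on UNIV (\<lambda>m :: 'a \<Rightarrow> complex. m \<circ> U)"
    by (rule continuous_on_coordinatewise_then_product) simp
  then have "closed {m :: 'a \<Rightarrow> complex. m \<circ> U \<in> B}"
    using continuous_on_closed_vimage[of UNIV "\<lambda>m :: 'a \<Rightarrow> complex. m \<circ> U"] B(2) by (auto simp: vimage_def)
  then have "closed B'" unfolding B'_def using closed_max_ideal_space by blast
  moreover have "is_boundary sc B'"
    unfolding is_boundary_def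
  proof (intro conjI allI)
    show "B' \<subseteq> M" by (simp add: B'_def)
    fix f
    obtain s where s: "s \<in> B" "\<And>m. m \<in> M \<Longrightarrow> cmod (m (inv U f)) \<le> cmod (s (inv U f))"
      using B(1) unfolding is_boundary_def by blast
    have "s \<in> M" using s(1) B(3) by blast
    then have "s \<circ> inv U \<in> M"
      using automorphism_inv unfolding algebra_automorphism_def max_ideal_space_def is_character_def by simp
    moreover have "(s \<circ> inv U) \<circ> U = s" using bij_U by (simp add: fun_eq_iff bij_is_inj)
    ultimately have "s \<circ> inv U \<in> B'" using s(1) by (simp only: B'_def Int_iff mem_Collect_eq)
    moreover have "cmod (m f) \<le> cmod ((s \<circ> inv U) f)" if "m \<in> M" for m
      using s(2)[OF char_comp_U[OF that]] bij_U by (simp add: bij_is_surj surj_f_inv_f)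
    ultimately show "\<exists>t\<in>B'. \<forall>m\<in>M. cmod (m f) \<le> cmod (t f)" by blast
  qed
  ultimately have "t \<in> B'"
    using assms unfolding shilov_boundary_def closedin_gelfand_iff B'_def by blast
  then show "t \<circ> U \<in> B" by (simp add: B'_def)
qed

lemma shilov_comp_U_pow: "t \<in> Sh \<Longrightarrow> t \<circ> (U ^^ n) \<in> Sh"
proof (induction n)
  case (Suc n)
  then have "(t \<circ> (U ^^ n)) \<circ> U \<in> Sh" by (intro shilov_comp_U)
  then show ?case by (simp only: comp_assoc funpow_Suc_right)
qed simp

lemma T_diff: "T (x - y) = T x - T y"
  by (simp add: T_def U_diff algebra_simps)

lemma T_sc: "T (sc c x) = sc c (T x)"
  by (simp add: T_def U_sc sc_mult_right)

lemma T_pow_diff: "(T ^^ n) (x - y) = (T ^^ n) x - (T ^^ n) y"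
  by (induction n) (simp_all add: T_diff)

lemma T_pow_sc: "(T ^^ n) (sc c x) = sc c ((T ^^ n) x)"
  by (induction n) (simp_all add: T_sc)

lemma T_pow_eq: "(T ^^ n) f = (T ^^ n) 1 * (U ^^ n) f"
  by (induction n) (simp_all add: T_def U_mult mult.assoc)

lemma char_T_pow_le:
  assumes "t \<in> Sh"
  shows "cmod (t ((T ^^ n) f)) \<le> gnorm ((T ^^ n) 1) * cmod ((t \<circ> (U ^^ n)) f)"
proof -
  have "t \<in> M" using assms shilov_subset by blast
  then have "t ((T ^^ n) f) = t ((T ^^ n) 1) * (t \<circ> (U ^^ n)) f"
    by (subst T_pow_eq) simp
  then show ?thesis using char_le_gnorm[OF assms] by (simp add: norm_mult mult_right_mono)
qed

lemma gnorm_T_pow_add: "gnorm ((T ^^ (m + n)) 1) \<le> gnorm ((T ^^ m) 1) * gnorm ((T ^^ n) 1)"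
proof (rule gnorm_leI)
  fix t assume t: "t \<in> Sh"
  have "cmod (t ((T ^^ (m + n)) 1)) \<le> gnorm ((T ^^ m) 1) * cmod ((t \<circ> (U ^^ m)) ((T ^^ n) 1))"
    using char_T_pow_le[OF t, of m "(T ^^ n) 1"] by (simp add: funpow_add)
  also have "\<dots> \<le> gnorm ((T ^^ m) 1) * gnorm ((T ^^ n) 1)"
    using char_le_gnorm[OF shilov_comp_U_pow[OF t]] char_le_gnorm[OF t, of "(T ^^ m) 1"]
    by (intro mult_left_mono) (auto intro: order_trans[OF norm_ge_zero])
  finally show "cmod (t ((T ^^ (m + n)) 1)) \<le> gnorm ((T ^^ m) 1) * gnorm ((T ^^ n) 1)" .
qed

lemma gnorm_T_pow_pos: "0 < gnorm ((T ^^ n) 1)"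
proof -
  obtain v where v: "w * v = 1" using invertible by blast
  have nz: "t ((T ^^ n) 1) \<noteq> 0" if "t \<in> M" for t
    using that
  proof (induction n arbitrary: t)
    case (Suc n)
    have "t w * t v = 1" using v Suc.prems by (metis char_1 char_mult)
    moreover have "(t \<circ> U) ((T ^^ n) 1) \<noteq> 0" using Suc char_comp_U by blast
    ultimately show ?case using Suc.prems by (auto simp: T_def[of "(T ^^ n) 1"])
  qed simp
  obtain t where t: "t \<in> Sh" using shilov_nonempty by blast
  then have "0 < cmod (t ((T ^^ n) 1))" using nz shilov_subset by auto
  also have "\<dots> \<le> gnorm ((T ^^ n) 1)" using t by (rule char_le_gnorm)
  finally show ?thesis .
qed

lemma check_op_in_check_algebra:
  assumes "g \<in> check_algebra sc"
  shows "check_op sc w U g \<in> check_algebra sc"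
  unfolding check_algebra_def
proof (intro CollectI conjI allI impI)
  show "check_op sc w U g \<in> extensional Sh" by (simp add: check_op_def)
  fix e :: real assume "0 < e"
  define d where "d = e / (norm w + 1)"
  have "0 < d" using \<open>0 < e\<close> by (simp add: d_def add_nonneg_pos)
  then obtain f where f: "\<And>t. t \<in> Sh \<Longrightarrow> cmod (g t - t f) < d"
    using assms unfolding check_algebra_def by blast
  have "cmod (check_op sc w U g t - t (T f)) < e" if t: "t \<in> Sh" for t
  proof -
    have tM: "t \<in> M" using t shilov_subset by blast
    have "cmod (check_op sc w U g t - t (T f)) = cmod (t w) * cmod (g (t \<circ> U) - (t \<circ> U) f)"
      using t tM by (simp add: check_op_def T_def flip: norm_mult right_diff_distrib)
    also have "\<dots> \<le> norm w * d"
      using f[OF shilov_comp_U[OF t]] char_le_norm[OF tM] by (intro mult_mono) auto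
    also have "\<dots> < e"
      using \<open>0 < e\<close> by (simp add: d_def pos_divide_less_eq add_nonneg_pos distrib_left)
    finally show ?thesis .
  qed
  then show "\<exists>f. \<forall>t\<in>Sh. cmod (check_op sc w U g t - t f) < e" by blast
qed

lemma check_op_pow_apply:
  assumes "g \<in> extensional Sh"
  shows "(check_op sc w U ^^ n) g = restrict (\<lambda>t. t ((T ^^ n) 1) * g (t \<circ> (U ^^ n))) Sh"
proof (induction n)
  case 0
  have "(\<lambda>t. t 1 * g (t \<circ> id)) t = g t" if "t \<in> Sh" for t
    using that shilov_subset by auto
  then show ?case using assms by (auto simp: fun_eq_iff restrict_def extensional_def)
next
  case (Suc n)
  have *: "t w * (restrict (\<lambda>t. t ((T ^^ n) 1) * g (t \<circ> (U ^^ n))) Sh) (t \<circ> U)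
      = t ((T ^^ Suc n) 1) * g (t \<circ> (U ^^ Suc n))" if "t \<in> Sh" for t
  proof -
    have "t \<in> M" using that shilov_subset by blast
    then show ?thesis using shilov_comp_U[OF that] by (simp add: T_def[of "(T ^^ n) 1"] comp_assoc)
  qed
  have "(check_op sc w U ^^ Suc n) g
      = check_op sc w U (restrict (\<lambda>t. t ((T ^^ n) 1) * g (t \<circ> (U ^^ n))) Sh)"
    by (simp only: funpow.simps comp_apply[of "check_op sc w U"] Suc.IH)
  also have "\<dots> = restrict (\<lambda>t. t ((T ^^ Suc n) 1) * g (t \<circ> (U ^^ Suc n))) Sh"
    unfolding check_op_def by (rule restrict_ext) (rule *)
  finally show ?case .
qed

lemma check_op_norm_pow: "check_op_norm sc (check_op sc w U ^^ n) = gnorm ((T ^^ n) 1)"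
proof (rule antisym)
  let ?S = "check_op sc w U ^^ n" and ?one = "restrict (\<lambda>_. 1) Sh :: ('a \<Rightarrow> complex) \<Rightarrow> complex"
  have le: "sup_norm sc (?S g) \<le> gnorm ((T ^^ n) 1)"
    if "g \<in> check_algebra sc" "sup_norm sc g \<le> 1" for g
    unfolding sup_norm_def
  proof (rule cSUP_least[OF shilov_nonempty])
    fix t assume t: "t \<in> Sh"
    have "cmod (g (t \<circ> (U ^^ n))) \<le> 1"
      using check_algebra_le_sup_norm[OF that(1) shilov_comp_U_pow[OF t]] that(2) by (rule order_trans)
    then have "cmod (t ((T ^^ n) 1)) * cmod (g (t \<circ> (U ^^ n))) \<le> gnorm ((T ^^ n) 1) * 1"
      using char_le_gnorm[OF t] gnorm_T_pow_pos[of n] by (intro mult_mono) auto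
    moreover have "g \<in> extensional Sh" using that(1) by (simp add: check_algebra_def)
    ultimately show "cmod (?S g t) \<le> gnorm ((T ^^ n) 1)"
      using t by (simp add: check_op_pow_apply norm_mult)
  qed
  have one: "?one \<in> {g \<in> check_algebra sc. sup_norm sc g \<le> 1}"
    using restrict_1_in_check_algebra unfolding sup_norm_def
    by (auto intro!: cSUP_least[OF shilov_nonempty])
  then show "check_op_norm sc ?S \<le> gnorm ((T ^^ n) 1)"
    unfolding check_op_norm_def using le by (intro cSUP_least) auto
  have "gnorm ((T ^^ n) 1) = sup_norm sc (?S ?one)"
    unfolding gnorm_def sup_norm_def using shilov_comp_U_pow
    by (intro SUP_cong refl) (simp add: check_op_pow_apply)
  also have "\<dots> \<le> check_op_norm sc ?S"
    unfolding check_op_norm_def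
    by (rule cSUP_upper[OF one]) (use le in \<open>auto intro!: bdd_aboveI[of _ "gnorm ((T ^^ n) 1)"]\<close>)
  finally show "gnorm ((T ^^ n) 1) \<le> check_op_norm sc ?S" .
qed

lemma T_pow_orbit_tendsto_0:
  assumes t: "t \<in> Sh" and summ: "summable (\<lambda>n. cmod x ^ n * gnorm ((T ^^ n) 1))"
  shows "(\<lambda>n. x ^ n * t ((T ^^ n) g)) \<longlonglongrightarrow> 0"
proof (rule Lim_null_comparison)
  have "(\<lambda>n. cmod x ^ n * gnorm ((T ^^ n) 1) * norm g) \<longlonglongrightarrow> 0 * norm g"
    by (intro tendsto_mult_right summable_LIMSEQ_zero summ)
  then show "(\<lambda>n. cmod x ^ n * gnorm ((T ^^ n) 1) * norm g) \<longlonglongrightarrow> 0" by simp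
  have "norm (x ^ n * t ((T ^^ n) g)) \<le> cmod x ^ n * gnorm ((T ^^ n) 1) * norm g" for n
  proof -
    have "cmod ((t \<circ> (U ^^ n)) g) \<le> norm g"
      using char_le_norm[OF subsetD[OF shilov_subset shilov_comp_U_pow[OF t]]] .
    then have "cmod (t ((T ^^ n) g)) \<le> gnorm ((T ^^ n) 1) * norm g"
      using char_T_pow_le[OF t, of n g] gnorm_T_pow_pos[of n]
      by (meson less_imp_le mult_left_mono order_trans)
    then show ?thesis
      by (simp add: norm_mult norm_power mult.assoc mult_left_mono)
  qed
  then show "\<forall>\<^sub>F n in sequentially. norm (x ^ n * t ((T ^^ n) g)) \<le> cmod x ^ n * gnorm ((T ^^ n) 1) * norm g"
    by simp
qed

lemma orbit_sums_outside:
  assumes t: "t \<in> Sh" and g: "T g - sc x g = f" and "x \<noteq> 0"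
    and summ: "summable (\<lambda>n. cmod (1 / x) ^ n * gnorm ((T ^^ n) 1))"
  shows "(\<lambda>n. t ((T ^^ n) f) / x ^ Suc n) sums (- t g)"
proof -
  have tM: "t \<in> M" using t shilov_subset by blast
  define d where "d n = (1 / x) ^ n * t ((T ^^ n) g)" for n
  have "d \<longlonglongrightarrow> 0"
    unfolding d_def by (rule T_pow_orbit_tendsto_0[OF t summ])
  then have "(\<lambda>n. d (Suc n) - d n) sums (0 - d 0)" by (rule telescope_sums)
  moreover have "d (Suc n) - d n = t ((T ^^ n) f) / x ^ Suc n" for n
  proof -
    have "(T ^^ n) f = (T ^^ Suc n) g - sc x ((T ^^ n) g)"
      unfolding g[symmetric] by (simp add: T_pow_diff T_pow_sc funpow_swap1)
    then have "t ((T ^^ n) f) = t ((T ^^ Suc n) g) - x * t ((T ^^ n) g)" using tM by simp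
    then show ?thesis using \<open>x \<noteq> 0\<close> by (simp add: d_def field_simps)
  qed
  ultimately show ?thesis by (simp add: d_def)
qed

lemma orbit_sums_inside:
  assumes t: "t \<in> Sh" and g: "g - sc x (T g) = T f"
    and summ: "summable (\<lambda>n. cmod x ^ n * gnorm ((T ^^ n) 1))"
  shows "(\<lambda>n. t ((T ^^ Suc n) f) * x ^ n) sums t g"
proof -
  have tM: "t \<in> M" using t shilov_subset by blast
  define d where "d n = x ^ n * t ((T ^^ n) g)" for n
  have "d \<longlonglongrightarrow> 0"
    unfolding d_def by (rule T_pow_orbit_tendsto_0[OF t summ])
  then have "(\<lambda>n. d n - d (Suc n)) sums (d 0 - 0)" by (rule telescope_sums')
  moreover have "d n - d (Suc n) = t ((T ^^ Suc n) f) * x ^ n" for n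
  proof -
    have "(T ^^ Suc n) f = (T ^^ n) (T f)" by (simp add: funpow_swap1)
    also have "\<dots> = (T ^^ n) g - sc x ((T ^^ Suc n) g)"
      unfolding g[symmetric] by (simp add: T_pow_diff T_pow_sc funpow_swap1)
    finally have "t ((T ^^ Suc n) f) = t ((T ^^ n) g) - x * t ((T ^^ Suc n) g)" using tM by simp
    then show ?thesis unfolding d_def by (simp only:) (simp add: algebra_simps)
  qed
  ultimately show ?thesis by (simp add: d_def)
qed

lemma resolvent_near:
  assumes R: "\<And>x. norm (R x) \<le> K * norm x" "\<And>x. R (T x - sc z x) = x" "\<And>x. T (R x) - sc z (R x) = x"
    and K: "0 < K"
  shows "\<exists>g L. (\<forall>x\<in>cball z (1 / (2 * K)). T (g x) - sc x (g x) = f) \<and>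
    (\<forall>x\<in>cball z (1 / (2 * K)). \<forall>y\<in>cball z (1 / (2 * K)). norm (g x - g y) \<le> L * cmod (x - y))"
proof -
  define D where "D = cball z (1 / (2 * K))"
  have R_diff: "R (x - y) = R x - R y" for x y
  proof -
    have "x - y = T (R x - R y) - sc z (R x - R y)"
      using R(3)[of x] R(3)[of y] by (simp add: T_diff sc_diff_right algebra_simps)
    then show ?thesis using R(2) by metis
  qed
  have D: "K * cmod (x - z) \<le> 1 / 2" if "x \<in> D" for x
    using that K by (simp add: D_def dist_norm norm_minus_commute field_simps)
  have R_le: "norm (R (sc (x - z) y)) \<le> 1 / 2 * norm y" if "x \<in> D" for x y
  proof -
    have "norm (R (sc (x - z) y)) \<le> K * cmod (x - z) * norm y"
      using R(1)[of "sc (x - z) y"] by (simp add: norm_sc mult.assoc)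
    also have "\<dots> \<le> 1 / 2 * norm y" using D[OF that] by (intro mult_right_mono) auto
    finally show ?thesis .
  qed
  have "\<exists>h. R (f + sc (x - z) h) = h" if "x \<in> D" for x
  proof -
    have "\<exists>!h. R (f + sc (x - z) h) = h"
    proof (rule banach_fix_type[of "1 / 2"])
      show "\<forall>h h'. dist (R (f + sc (x - z) h)) (R (f + sc (x - z) h')) \<le> 1 / 2 * dist h h'"
        using R_le[OF that] by (simp add: dist_norm flip: R_diff sc_diff_right)
    qed auto
    then show ?thesis by blast
  qed
  then obtain g where g: "\<And>x. x \<in> D \<Longrightarrow> R (f + sc (x - z) (g x)) = g x" by metis
  have "T (g x) - sc x (g x) = f" if "x \<in> D" for x
    using R(3)[of "f + sc (x - z) (g x)"] g[OF that] by (simp add: sc_diff_left algebra_simps)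
  moreover have "norm (g x - g y) \<le> 4 * K * K * norm f * cmod (x - y)" if "x \<in> D" "y \<in> D" for x y
  proof -
    have "g y - R (sc (y - z) (g y)) = R f"
      using R_diff[of "f + sc (y - z) (g y)" "sc (y - z) (g y)"] g[OF that(2)] by simp
    then have "norm (g y) \<le> norm (R f) + norm (R (sc (y - z) (g y)))"
      by (metis add.commute diff_add_cancel norm_triangle_ineq)
    then have gy: "norm (g y) \<le> 2 * K * norm f" using R_le[OF that(2), of "g y"] R(1)[of f] by simp
    have "g x - g y = R (sc (x - z) (g x) - sc (y - z) (g y))"
      using R_diff[of "f + sc (x - z) (g x)" "f + sc (y - z) (g y)"] g that by simp
    also have "sc (x - z) (g x) - sc (y - z) (g y) = sc (x - z) (g x - g y) - sc (y - x) (g y)"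
      by (simp add: sc_diff_left sc_diff_right)
    finally have "norm (g x - g y) \<le> norm (R (sc (x - z) (g x - g y))) + norm (R (sc (y - x) (g y)))"
      by (metis R_diff norm_triangle_ineq4)
    moreover have "norm (R (sc (y - x) (g y))) \<le> K * (cmod (x - y) * (2 * K * norm f))"
      by (rule order_trans[OF R(1)])
        (use gy K in \<open>auto simp: norm_sc norm_minus_commute intro!: mult_left_mono\<close>)
    ultimately show ?thesis using R_le[OF that(1), of "g x - g y"] by (simp add: algebra_simps)
  qed
  ultimately show ?thesis unfolding D_def by blast
qed

lemma U_inv: "U (inv U x) = x" and inv_U: "inv U (U x) = x"
  using bij_U by (simp_all add: bij_is_surj surj_f_inv_f bij_is_inj)

lemma inv_U_pow: "(inv U ^^ n) ((U ^^ n) x) = x"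
  by (induction n arbitrary: x) (simp_all add: funpow_swap1 inv_U)

lemma weighted_automorphism_inverse:
  assumes "w * v = 1"
  shows "weighted_automorphism sc (inv U) (inv U v)"
proof
  show "algebra_automorphism sc (inv U)" by (rule automorphism_inv)
  have "inv U (v * w) = inv U v * inv U w"
    using automorphism_inv by (simp add: algebra_automorphism_def)
  then show "\<exists>x. inv U v * x = 1"
    using assms automorphism_inv by (metis algebra_automorphism_def mult.commute)
qed

lemma inv_into_check_op:
  assumes v: "w * v = 1" and g: "g \<in> check_algebra sc"
  shows "inv_into (check_algebra sc) (check_op sc w U) g = check_op sc (inv U v) (inv U) g"
proof -
  interpret bwd: weighted_automorphism sc "inv U" "inv U v"
    by (rule weighted_automorphism_inverse[OF v])
  have ext: "g \<in> extensional Sh" if "g \<in> check_algebra sc" for g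
    using that by (simp add: check_algebra_def)
  have left: "check_op sc (inv U v) (inv U) (check_op sc w U g) = g" if "g \<in> check_algebra sc" for g
  proof (rule extensionalityI[of _ Sh])
    fix t assume t: "t \<in> Sh"
    have tM: "t \<in> M" using t shilov_subset by blast
    have "t (inv U v) * t (inv U w) = t (inv U (w * v))"
      using tM bwd.U_mult[of v w] by (simp add: mult.commute)
    also have "\<dots> = 1" using v tM bwd.U_1 by simp
    finally have "t (inv U v) * (t (inv U w) * g t) = g t" by (simp flip: mult.assoc)
    moreover have "(t \<circ> inv U) \<circ> U = t" by (simp add: fun_eq_iff inv_U)
    ultimately show "check_op sc (inv U v) (inv U) (check_op sc w U g) t = g t"
      using t bwd.shilov_comp_U[OF t] by (simp add: check_op_def)
  qed (use ext[OF that] in \<open>simp_all add: check_op_def\<close>)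
  have right: "check_op sc w U (check_op sc (inv U v) (inv U) g) = g"
  proof (rule extensionalityI[of _ Sh])
    fix t assume t: "t \<in> Sh"
    have tM: "t \<in> M" using t shilov_subset by blast
    have "t w * t v = 1" using v tM by (metis char_1 char_mult)
    then have "t w * (t (U (inv U v)) * g t) = g t" by (simp add: U_inv flip: mult.assoc)
    moreover have "(t \<circ> U) \<circ> inv U = t" by (simp add: fun_eq_iff U_inv)
    ultimately show "check_op sc w U (check_op sc (inv U v) (inv U) g) t = g t"
      using t shilov_comp_U[OF t] by (simp add: check_op_def)
  qed (use ext[OF g] in \<open>simp_all add: check_op_def\<close>)
  have "inj_on (check_op sc w U) (check_algebra sc)" by (rule inj_on_inverseI[where g = "check_op sc (inv U v) (inv U)"]) (rule left)
  from inv_into_f_f[OF this bwd.check_op_in_check_algebra[OF g]] show ?thesis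
    by (simp only: right)
qed

lemma check_op_norm_inverse_pow:
  assumes v: "w * v = 1"
  shows "check_op_norm sc (inv_into (check_algebra sc) (check_op sc w U) ^^ n)
    = check_op_norm sc (check_op sc (inv U v) (inv U) ^^ n)"
proof -
  interpret bwd: weighted_automorphism sc "inv U" "inv U v"
    by (rule weighted_automorphism_inverse[OF v])
  have "(inv_into (check_algebra sc) (check_op sc w U) ^^ n) g = (check_op sc (inv U v) (inv U) ^^ n) g \<and>
      (check_op sc (inv U v) (inv U) ^^ n) g \<in> check_algebra sc" if "g \<in> check_algebra sc" for g
    by (induction n) (auto simp: that inv_into_check_op[OF v] bwd.check_op_in_check_algebra)
  then show ?thesis unfolding check_op_norm_def by (intro SUP_cong) auto
qed

lemma separating_neighbourhood:
  assumes t: "t \<in> M" and N: "\<And>n. 0 < n \<Longrightarrow> n < N \<Longrightarrow> t \<circ> (U ^^ n) \<noteq> t"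
  obtains V where "open V" and "t \<in> V" and "\<And>s n. s \<in> V \<Longrightarrow> 0 < n \<Longrightarrow> n < N \<Longrightarrow> s \<circ> (U ^^ n) \<notin> V"
proof -
  have "\<exists>h. t ((U ^^ n) h) \<noteq> t h" if "n \<in> {0<..<N}" for n
    using N[of n] that by (auto simp: fun_eq_iff)
  then obtain h where h: "\<And>n. n \<in> {0<..<N} \<Longrightarrow> t ((U ^^ n) (h n)) \<noteq> t (h n)" by metis
  define d where "d n = cmod (t ((U ^^ n) (h n)) - t (h n)) / 2" for n
  define V where "V = (\<Inter>n\<in>{0<..<N}. {s. cmod (s (h n) - t (h n)) < d n} \<inter>
      {s. cmod (s ((U ^^ n) (h n)) - t ((U ^^ n) (h n))) < d n})"
  show thesis
  proof
    show "open V" unfolding V_def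
      by (intro open_INT ballI open_Int open_Collect_less continuous_on_norm continuous_on_diff
        continuous_on_product_coordinates continuous_on_const) auto
    show "t \<in> V" using h by (auto simp: V_def d_def)
    fix s n assume s: "s \<in> V" and n: "0 < n" "n < N"
    show "s \<circ> (U ^^ n) \<notin> V"
    proof
      assume "s \<circ> (U ^^ n) \<in> V"
      then have "cmod (s ((U ^^ n) (h n)) - t (h n)) < d n" using n by (auto simp: V_def)
      moreover have "cmod (s ((U ^^ n) (h n)) - t ((U ^^ n) (h n))) < d n" using s n by (auto simp: V_def)
      ultimately show False
        using norm_triangle_ineq4[of "s ((U ^^ n) (h n)) - t (h n)" "s ((U ^^ n) (h n)) - t ((U ^^ n) (h n))"]
        by (simp add: d_def)
    qed
  qed
qed

lemma unbounded_periods: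
  assumes "\<And>n. 1 \<le> n \<Longrightarrow> U ^^ n \<noteq> id"
  shows "\<exists>t\<in>Sh. \<forall>n. 0 < n \<longrightarrow> n < N \<longrightarrow> t \<circ> (U ^^ n) \<noteq> t"
proof (rule ccontr)
  assume neg: "\<not> ?thesis"
  have "(U ^^ fact N) x - x = 0" for x
  proof (rule semisimple_shilov)
    fix t assume t: "t \<in> Sh"
    obtain n where n: "0 < n" "n < N" "t \<circ> (U ^^ n) = t" using neg t by blast
    have iter: "t ((U ^^ (n * k)) y) = t y" for k y
    proof (induction k)
      case (Suc k)
      have "t ((U ^^ (n * Suc k)) y) = (t \<circ> (U ^^ n)) ((U ^^ (n * k)) y)" by (simp add: funpow_add)
      then show ?case using Suc n(3) by simp
    qed simp
    have "n dvd fact N" using n by (intro dvd_fact) auto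
    then obtain k where "fact N = n * k" by blast
    then show "t ((U ^^ fact N) x - x) = 0" using iter[of k x] t shilov_subset by (simp add: subset_iff)
  qed
  then have "U ^^ fact N = id" by (simp add: fun_eq_iff)
  then show False using assms[of "fact N"] fact_ge_1[of N, where 'a=nat] by blast
qed

theorem sphere_subset_op_spectrum:
  assumes aperiodic: "\<And>n. 1 \<le> n \<Longrightarrow> U ^^ n \<noteq> id"
    and summ: "(\<lambda>n::int. \<bar>ln (check_op_norm sc (check_op_pow sc w U n))\<bar> / (1 + (real_of_int n)\<^sup>2))
      summable_on UNIV"
  shows "sphere 0 1 \<subseteq> op_spectrum sc T"
proof (rule subsetI, rule ccontr)
  fix z :: complex assume "z \<in> sphere 0 1" and notin: "z \<notin> op_spectrum sc T"
  then have z: "cmod z = 1" by simp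
  obtain v where v: "w * v = 1" using invertible by blast
  interpret bwd: weighted_automorphism sc "inv U" "inv U v"
    by (rule weighted_automorphism_inverse[OF v])
  have T_bwd: "bwd.T (T f) = f" for f
  proof -
    have "bwd.T (T f) = inv U (v * (w * U f))" by (simp add: bwd.T_def T_def bwd.U_mult)
    also have "v * (w * U f) = (w * v) * U f" by (simp add: mult_ac)
    finally show ?thesis using v by (simp add: inv_U)
  qed
  obtain R K0 where R: "\<And>x. norm (R x) \<le> K0 * norm x" "\<And>x. R (T x - sc z x) = x" "\<And>x. T (R x) - sc z (R x) = x"
    using notin unfolding op_spectrum_def by blast
  define K where "K = max K0 1"
  have "0 < K" by (simp add: K_def)
  have RK: "norm (R x) \<le> K * norm x" for x
    by (rule order_trans[OF R(1)]) (simp add: K_def mult_right_mono)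
  define \<delta> where "\<delta> = 1 / (4 * K)"
  have "0 < \<delta>" using \<open>0 < K\<close> by (simp add: \<delta>_def)
  have \<delta>2: "2 * \<delta> = 1 / (2 * K)" by (simp add: \<delta>_def)

  define A where "A n = gnorm ((T ^^ n) 1)" for n
  define B where "B n = gnorm ((bwd.T ^^ n) 1)" for n
  define q where "q n = max 0 (ln (A n)) + max 0 (ln (B n))" for n
  have A_pos: "0 < A n" and B_pos: "0 < B n" for n
    by (simp_all add: A_def B_def gnorm_T_pow_pos bwd.gnorm_T_pow_pos)
  have le_exp: "x \<le> exp y" if "0 < x" "ln x \<le> y" for x y :: real
    using that exp_le_cancel_iff[of "ln x" y] by simp
  have A_le: "A n \<le> exp (q n)" and B_le: "B n \<le> exp (q n)" for n
    by (intro le_exp A_pos B_pos; simp add: q_def)+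
  have q_nonneg: "0 \<le> q n" for n by (simp add: q_def)
  have q_add: "q (m + n) \<le> q m + q n" for m n
  proof -
    have "ln (A (m + n)) \<le> ln (A m * A n)"
      using gnorm_T_pow_add[of m n] A_pos by (simp add: A_def)
    moreover have "ln (B (m + n)) \<le> ln (B m * B n)"
      using bwd.gnorm_T_pow_add[of m n] B_pos by (simp add: B_def)
    ultimately show ?thesis
      unfolding q_def ln_mult_pos[OF A_pos A_pos] ln_mult_pos[OF B_pos B_pos] by linarith
  qed
  have q_summable: "summable (\<lambda>n. q n / (1 + (real n)\<^sup>2))"
  proof (rule summable_comparison_test'[where N = 0])
    let ?F = "\<lambda>n::int. \<bar>ln (check_op_norm sc (check_op_pow sc w U n))\<bar> / (1 + (real_of_int n)\<^sup>2)"
    have reindex: "summable (\<lambda>n. ?F (h n))" if "inj h" for h :: "nat \<Rightarrow> int"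
    proof -
      have "?F summable_on range h" by (rule summable_on_subset_banach[OF summ]) simp
      then have "(?F \<circ> h) summable_on UNIV" using that by (simp add: summable_on_reindex)
      then show ?thesis by (intro summable_on_imp_summable) (simp add: comp_def)
    qed
    have "check_op_norm sc (check_op_pow sc w U (int n)) = A n" for n
      by (simp add: check_op_pow_def check_op_norm_pow A_def)
    then have "summable (\<lambda>n. \<bar>ln (A n)\<bar> / (1 + (real n)\<^sup>2))"
      using reindex[of int] by (simp add: inj_def)
    moreover have "check_op_norm sc (check_op_pow sc w U (- int n)) = B n" for n
    proof (cases "n = 0")
      case True
      then show ?thesis using check_op_norm_pow[of 0] by (simp add: check_op_pow_def B_def)
    next
      case False
      then show ?thesis
        by (simp add: check_op_pow_def check_op_norm_inverse_pow[OF v] bwd.check_op_norm_pow B_def)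
    qed
    then have "summable (\<lambda>n. \<bar>ln (B n)\<bar> / (1 + (real n)\<^sup>2))"
      using reindex[of "\<lambda>n. - int n"] by (simp add: inj_def)
    ultimately show "summable (\<lambda>n. \<bar>ln (A n)\<bar> / (1 + (real n)\<^sup>2) + \<bar>ln (B n)\<bar> / (1 + (real n)\<^sup>2))"
      by (rule summable_add)
    show "norm (q n / (1 + (real n)\<^sup>2)) \<le> \<bar>ln (A n)\<bar> / (1 + (real n)\<^sup>2) + \<bar>ln (B n)\<bar> / (1 + (real n)\<^sup>2)" for n
      using q_nonneg[of n] unfolding add_divide_distrib[symmetric]
      by (simp add: q_def) (intro divide_right_mono; simp)
  qed
  obtain m where m: "\<And>J. (\<Sum>j<J. real (m j) * (pi / (3 * 2 ^ j))) \<le> \<delta>"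
    and summ_m: "summable (\<lambda>n. exp (q n) / 2 ^ m (floor_log n))"
    using nonquasianalytic_multiplicities[OF q_nonneg q_add q_summable \<open>0 < \<delta>\<close>] by blast
  have abel: "summable (\<lambda>n. r ^ n * exp (q n))" if "0 < r" "r < 1" for r
    using summable_exp_subadditive[OF q_nonneg q_add q_summable that] .

  have char_T_pow_le_exp: "cmod (t ((T ^^ n) f)) \<le> exp (q n) * cmod ((t \<circ> (U ^^ n)) f)" if "t \<in> Sh" for t n f
    using char_T_pow_le[OF that, of n f] A_le[of n] unfolding A_def
    by (meson mult_right_mono norm_ge_zero order_trans)
  have char_bwd_pow_le_exp: "cmod (t ((bwd.T ^^ n) f)) \<le> exp (q n) * cmod ((t \<circ> (inv U ^^ n)) f)" if "t \<in> Sh" for t n f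
    using bwd.char_T_pow_le[OF that, of n f] B_le[of n] unfolding B_def
    by (meson mult_right_mono norm_ge_zero order_trans)
  have localized: "1 \<le> (\<Sum>n. (cmod (t ((T ^^ Suc n) f)) + cmod (t ((bwd.T ^^ Suc n) f))) / 2 ^ m (floor_log (Suc n)))"
    if t: "t \<in> Sh" and tf: "t f = 1" and f: "\<And>s. s \<in> M \<Longrightarrow> cmod (s f) \<le> 1" for t f
  proof -
    have tM: "t \<in> M" using t shilov_subset by blast
    obtain g L where g: "\<And>x. x \<in> cball z (2 * \<delta>) \<Longrightarrow> T (g x) - sc x (g x) = f"
      and Lip: "\<And>x y. x \<in> cball z (2 * \<delta>) \<Longrightarrow> y \<in> cball z (2 * \<delta>) \<Longrightarrow> norm (g x - g y) \<le> L * cmod (x - y)"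
      using resolvent_near[OF RK R(2,3) \<open>0 < K\<close>, of f] unfolding \<delta>2 by blast
    have a_le: "cmod (t ((T ^^ n) f)) \<le> exp (q n)" for n
      using char_T_pow_le_exp[OF t, of n f] f[OF subsetD[OF shilov_subset shilov_comp_U_pow[OF t]]]
      by (meson exp_ge_zero mult_left_le order_trans)
    have b_le: "cmod (t ((bwd.T ^^ n) f)) \<le> exp (q n)" for n
      using char_bwd_pow_le_exp[OF t, of n f] f[OF subsetD[OF shilov_subset bwd.shilov_comp_U_pow[OF t]]]
      by (meson exp_ge_zero mult_left_le order_trans)
    have "cmod (t ((T ^^ 0) f)) \<le> (\<Sum>n. (cmod (t ((T ^^ Suc n) f)) + cmod (t ((bwd.T ^^ Suc n) f))) / 2 ^ m (floor_log (Suc n)))"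
    proof (rule bilateral_sequence_local_bound[where G = "\<lambda>x. t (g x)" and L = L, OF z \<open>0 < \<delta>\<close> _ _ _ m])
      show "cmod (t (g x) - t (g y)) \<le> L * cmod (x - y)" if "x \<in> cball z (2 * \<delta>)" "y \<in> cball z (2 * \<delta>)" for x y
        using char_le_norm[OF tM, of "g x - g y"] Lip[OF that] tM by simp
      show "(\<lambda>n. t ((T ^^ n) f) / x ^ Suc n) sums - t (g x)" if "x \<in> cball z (2 * \<delta>)" "1 < cmod x" for x
      proof (rule orbit_sums_outside[OF t g[OF that(1)]])
        show "x \<noteq> 0" using that(2) by auto
        show "summable (\<lambda>n. cmod (1 / x) ^ n * gnorm ((T ^^ n) 1))"
        proof (rule summable_comparison_test'[where N = 0])
          show "summable (\<lambda>n. cmod (1 / x) ^ n * exp (q n))"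
            using that(2) by (intro abel) (auto simp: norm_divide divide_less_eq)
          show "norm (cmod (1 / x) ^ n * gnorm ((T ^^ n) 1)) \<le> cmod (1 / x) ^ n * exp (q n)" for n
            using A_le[of n] A_pos[of n] by (simp add: A_def abs_mult mult_left_mono del: norm_divide)
        qed
      qed
      show "(\<lambda>n. t ((bwd.T ^^ Suc n) f) * x ^ n) sums t (g x)" if "x \<in> cball z (2 * \<delta>)" "cmod x < 1" for x
      proof (rule bwd.orbit_sums_inside[OF t])
        show "g x - sc x (bwd.T (g x)) = bwd.T f"
          unfolding g[OF that(1), symmetric] by (simp add: bwd.T_diff bwd.T_sc T_bwd)
        show "summable (\<lambda>n. cmod x ^ n * gnorm ((bwd.T ^^ n) 1))"
        proof (rule summable_comparison_test'[where N = 0])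
          show "summable (\<lambda>n. max (cmod x) (1 / 2) ^ n * exp (q n))"
            using that(2) by (intro abel) auto
          show "norm (cmod x ^ n * gnorm ((bwd.T ^^ n) 1)) \<le> max (cmod x) (1 / 2) ^ n * exp (q n)" for n
            using B_le[of n] B_pos[of n] by (auto simp: B_def abs_mult intro!: mult_mono power_mono)
        qed
      qed
      have ab_le: "cmod (t ((T ^^ n) f)) + cmod (t ((bwd.T ^^ n) f)) \<le> 2 * exp (q n)" for n
        using a_le[of n] b_le[of n] by linarith
      show "summable (\<lambda>n. r ^ n * (cmod (t ((T ^^ n) f)) + cmod (t ((bwd.T ^^ n) f))))" if r: "0 < r" "r < 1" for r
      proof (rule summable_comparison_test'[where N = 0])
        show "summable (\<lambda>n. 2 * (r ^ n * exp (q n)))" by (intro summable_mult abel r)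
        show "norm (r ^ n * (cmod (t ((T ^^ n) f)) + cmod (t ((bwd.T ^^ n) f)))) \<le> 2 * (r ^ n * exp (q n))" for n
          using mult_left_mono[OF ab_le[of n], of "r ^ n"] r by (simp add: abs_mult mult_ac)
      qed
      show "summable (\<lambda>n. (cmod (t ((T ^^ n) f)) + cmod (t ((bwd.T ^^ n) f))) / 2 ^ m (floor_log n))"
      proof (rule summable_comparison_test'[where N = 0])
        show "summable (\<lambda>n. 2 * (exp (q n) / 2 ^ m (floor_log n)))" by (intro summable_mult summ_m)
        show "norm ((cmod (t ((T ^^ n) f)) + cmod (t ((bwd.T ^^ n) f))) / 2 ^ m (floor_log n))
            \<le> 2 * (exp (q n) / 2 ^ m (floor_log n))" for n
          using divide_right_mono[OF ab_le[of n], of "2 ^ m (floor_log n)"] by simp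
      qed
    qed
    then show ?thesis using tf by simp
  qed
  define E where "E n = 2 * exp (q (Suc n)) / 2 ^ m (floor_log (Suc n))" for n
  have E_nonneg: "0 \<le> E n" for n by (simp add: E_def)
  have E_summable: "summable E"
    using summable_mult[OF summ_m, of 2, THEN summable_Suc_iff[THEN iffD2]] by (simp add: E_def[abs_def])
  obtain N where N: "\<And>k. k \<ge> N \<Longrightarrow> norm (\<Sum>n. E (n + k)) < 1 / 2"
    using suminf_exist_split[OF _ E_summable, of "1 / 2"] by auto
  define \<epsilon> where "\<epsilon> = 1 / (2 * (suminf E + 1))"
  have "0 \<le> suminf E" using E_nonneg by (intro suminf_nonneg E_summable)
  then have "0 < \<epsilon>" and \<epsilon>E: "\<epsilon> * suminf E < 1 / 2" by (simp_all add: \<epsilon>_def field_simps)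
  obtain t0 where t0: "t0 \<in> Sh" "\<And>n. 0 < n \<Longrightarrow> n < Suc N \<Longrightarrow> t0 \<circ> (U ^^ n) \<noteq> t0"
    using unbounded_periods[OF aperiodic, of "Suc N"] by blast
  obtain V where V: "open V" "t0 \<in> V" "\<And>s n. s \<in> V \<Longrightarrow> 0 < n \<Longrightarrow> n < Suc N \<Longrightarrow> s \<circ> (U ^^ n) \<notin> V"
    by (rule separating_neighbourhood[OF subsetD[OF shilov_subset t0(1)] t0(2)]) auto
  obtain f t where t: "t \<in> Sh" "t \<in> V" "t f = 1" and f: "\<And>s. s \<in> M \<Longrightarrow> cmod (s f) \<le> 1"
    and f_small: "\<And>s. s \<in> M \<Longrightarrow> s \<notin> V \<Longrightarrow> cmod (s f) < \<epsilon>"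
    by (rule shilov_boundary_peak[OF t0(1) V(1,2) \<open>0 < \<epsilon>\<close>]) (erule that; assumption)
  define c where "c n = (cmod (t ((T ^^ Suc n) f)) + cmod (t ((bwd.T ^^ Suc n) f))) / 2 ^ m (floor_log (Suc n))" for n
  have c_bound: "c n \<le> y * E n"
    if "cmod ((t \<circ> (U ^^ Suc n)) f) \<le> y" "cmod ((t \<circ> (inv U ^^ Suc n)) f) \<le> y" for n y
  proof -
    have "cmod (t ((T ^^ Suc n) f)) \<le> exp (q (Suc n)) * y"
      using char_T_pow_le_exp[OF t(1), of "Suc n" f] that(1) by (meson exp_ge_zero mult_left_mono order_trans)
    moreover have "cmod (t ((bwd.T ^^ Suc n) f)) \<le> exp (q (Suc n)) * y"
      using char_bwd_pow_le_exp[OF t(1), of "Suc n" f] that(2) by (meson exp_ge_zero mult_left_mono order_trans)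
    ultimately have "cmod (t ((T ^^ Suc n) f)) + cmod (t ((bwd.T ^^ Suc n) f)) \<le> y * (2 * exp (q (Suc n)))"
      by (simp only: mult.commute[of y])
    then show ?thesis
      unfolding c_def E_def times_divide_eq_right by (intro divide_right_mono) auto
  qed
  have orbit: "t \<circ> (U ^^ n) \<in> M" "t \<circ> (inv U ^^ n) \<in> M" for n
    using shilov_comp_U_pow[OF t(1)] bwd.shilov_comp_U_pow[OF t(1)] shilov_subset by (blast, blast)
  have c_le: "c n \<le> E n" for n
    using c_bound[OF f[OF orbit(1)] f[OF orbit(2)]] by simp
  have c_small: "c n \<le> \<epsilon> * E n" if "n < N" for n
  proof (rule c_bound)
    show "cmod ((t \<circ> (U ^^ Suc n)) f) \<le> \<epsilon>"
      using V(3)[OF t(2), of "Suc n"] that f_small[OF orbit(1)] by (intro less_imp_le) blast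
    have "(t \<circ> (inv U ^^ Suc n)) \<circ> (U ^^ Suc n) = t"
      by (simp only: fun_eq_iff comp_apply inv_U_pow simp_thms)
    then have "t \<circ> (inv U ^^ Suc n) \<notin> V"
      using V(3)[of "t \<circ> (inv U ^^ Suc n)" "Suc n"] that t(2) by auto
    then show "cmod ((t \<circ> (inv U ^^ Suc n)) f) \<le> \<epsilon>"
      using f_small[OF orbit(2)] by (intro less_imp_le) blast
  qed
  have c_summable: "summable c"
    by (rule summable_comparison_test'[OF E_summable, where N = 0]) (use c_le in \<open>simp add: c_def\<close>)
  have "1 \<le> suminf c" unfolding c_def by (rule localized[where t = t and f = f, OF t(1,3)]) (rule f)
  also have "suminf c = (\<Sum>n. c (n + N)) + (\<Sum>n<N. c n)"
    by (rule suminf_split_initial_segment[OF c_summable])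
  also have "(\<Sum>n. c (n + N)) \<le> (\<Sum>n. E (n + N))"
    using c_summable E_summable by (intro suminf_le c_le) (simp_all add: summable_iff_shift)
  also have "(\<Sum>n. E (n + N)) \<le> 1 / 2" using N[of N] by simp
  also have "(\<Sum>n<N. c n) \<le> (\<Sum>n<N. \<epsilon> * E n)" by (intro sum_mono c_small) simp
  also have "\<dots> \<le> \<epsilon> * suminf E"
    unfolding sum_distrib_left[symmetric] using \<open>0 < \<epsilon>\<close> E_nonneg
    by (intro mult_left_mono sum_le_suminf E_summable) auto
  finally show False using \<epsilon>E by linarith
qed

end

theorem theorem2:
  fixes sc :: "complex \<Rightarrow> 'a::{banach,real_normed_algebra_1,comm_ring_1} \<Rightarrow> 'a"
    and U :: "'a \<Rightarrow> 'a" and w :: 'a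
  assumes "complex_banach_algebra sc"
    and "semisimple sc"
    and "algebra_automorphism sc U"
    and "\<exists>v. w * v = 1"
    and "\<forall>n::nat. n \<ge> 1 \<longrightarrow> U ^^ n \<noteq> id"
    and "(\<lambda>n::int. \<bar>ln (check_op_norm sc (check_op_pow sc w U n))\<bar> / (1 + (real_of_int n)\<^sup>2))
           summable_on UNIV"
  shows "sphere 0 1 \<subseteq> op_spectrum sc (\<lambda>f. w * U f)"
proof -
  interpret weighted_automorphism sc U w
    using assms by unfold_locales auto
  have "T = (\<lambda>f. w * U f)" by (simp add: T_def fun_eq_iff)
  then show ?thesis using sphere_subset_op_spectrum assms by auto
qed

end
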